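(* Let $(\Omega,\Omega^\Omega)$ be a sample space and let $\mathbf{QMS}$ be the category of quasi-measurable spaces and quasi-measurable maps with respect to $(\Omega,\Omega^\Omega)$. Then $\mathbf{QMS}$ is locally cartesian closed, with the one-point space $\mathbf 1$ as terminal object; i.e. for every quasi-measurable space $\mathcal T$ the slice category $\mathbf{QMS}_{\mathcal T}$ of quasi-measurable spaces over $\mathcal T$ is cartesian closed.
   Context: A sample space $(\Omega,\Omega^\Omega)$ consists of a non-empty set $\Omega$ and a set $\Omega^\Omega$ of maps $\Omega\to\Omega$ that contains the identity map and all constant maps and is closed under composition. A quasi-measurable space (w.r.t. $(\Omega,\Omega^\Omega)$) is a pair $(\mathcal X,\mathcal X^\Omega)$ of a set $\mathcal X$ and a set $\mathcal X^\Omega$ of maps $X:\Omega\to\mathcal X$ containing all constant maps and all compositions $X\circ\Phi$ with $X\in\mathcal X^\Omega$, $\Phi\in\Omega^\Omega$. (The empty set with $\emptyset^\Omega=\emptyset$ is a quasi-measurable space.) A quasi-measurable map $(\mathcal X,\mathcal X^\Omega)\to(\mathcal Y,\mathcal Y^\Omega)$ is a map $g:\mathcal X\to\mathcal Y$ with $g\circ X\in\mathcal Y^\Omega$ for all $X\in\mathcal X^\Omega$. The one-point space $\mathbf 1$ is $\{0\}$ with the unique map $\Omega\to\{0\}$ as its only admissible random variable. The objects of the slice category $\mathbf{QMS}_{\mathcal T}$ are quasi-measurable maps $T_{\mathcal X}:\mathcal X\to\mathcal T$, and its morphisms from $T_{\mathcal X}$ to $T_{\mathcal Y}$ are quasi-measurable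 maps $g:\mathcal X\to\mathcal Y$ with $T_{\mathcal Y}\circ g=T_{\mathcal X}$. *)

theory Defs
  imports Main "HOL-Library.FuncSet" "HOL-Library.Equipollence"
begin

section \<open>Categories\<close>

text \<open>Categories are given by a family of hom-sets. The hom-sets need not be disjoint, so
  composition takes the three objects as arguments; \<open>Comp C a b c g f\<close> is the composite of
  \<open>f : a \<rightarrow> b\<close> and \<open>g : b \<rightarrow> c\<close>.\<close>

datatype ('o, 'm) cat = Cat
  (Obj: "'o set")
  (Hom: "'o \<Rightarrow> 'o \<Rightarrow> 'm set")
  (Id: "'o \<Rightarrow> 'm")
  (Comp: "'o \<Rightarrow> 'o \<Rightarrow> 'o \<Rightarrow> 'm \<Rightarrow> 'm \<Rightarrow> 'm")

definition category :: "('o, 'm) cat \<Rightarrow> bool" where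
  "category C \<longleftrightarrow>
     (\<forall>a\<in>Obj C. Id C a \<in> Hom C a a) \<and>
     (\<forall>a\<in>Obj C. \<forall>b\<in>Obj C. \<forall>c\<in>Obj C. \<forall>f\<in>Hom C a b. \<forall>g\<in>Hom C b c.
        Comp C a b c g f \<in> Hom C a c) \<and>
     (\<forall>a\<in>Obj C. \<forall>b\<in>Obj C. \<forall>f\<in>Hom C a b.
        Comp C a a b f (Id C a) = f \<and> Comp C a b b (Id C b) f = f) \<and>
     (\<forall>a\<in>Obj C. \<forall>b\<in>Obj C. \<forall>c\<in>Obj C. \<forall>d\<in>Obj C.
        \<forall>f\<in>Hom C a b. \<forall>g\<in>Hom C b c. \<forall>h\<in>Hom C c d.
        Comp C a c d h (Comp C a b c g f) = Comp C a b d (Comp C b c d h g) f)"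

definition is_terminal :: "('o, 'm) cat \<Rightarrow> 'o \<Rightarrow> bool" where
  "is_terminal C t \<longleftrightarrow> t \<in> Obj C \<and> (\<forall>z\<in>Obj C. \<exists>!h. h \<in> Hom C z t)"

definition is_product :: "('o, 'm) cat \<Rightarrow> 'o \<Rightarrow> 'o \<Rightarrow> 'o \<Rightarrow> 'm \<Rightarrow> 'm \<Rightarrow> bool" where
  "is_product C a b p \<pi>\<^sub>1 \<pi>\<^sub>2 \<longleftrightarrow>
     p \<in> Obj C \<and> \<pi>\<^sub>1 \<in> Hom C p a \<and> \<pi>\<^sub>2 \<in> Hom C p b \<and>
     (\<forall>z\<in>Obj C. \<forall>f\<in>Hom C z a. \<forall>g\<in>Hom C z b.
        \<exists>!h. h \<in> Hom C z p \<and> Comp C z p a \<pi>\<^sub>1 h = f \<and> Comp C z p b \<pi>\<^sub>2 h = g)"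

text \<open>\<open>e\<close> is an exponential \<open>b\<^sup>a\<close> with evaluation \<open>ev : e \<times> a \<rightarrow> b\<close>, where \<open>(p, \<pi>\<^sub>1, \<pi>\<^sub>2)\<close> is a
  product of \<open>e\<close> and \<open>a\<close>. The arrow \<open>k\<close> below is \<open>h \<times> id\<^sub>a\<close>.\<close>

definition is_exponential ::
    "('o, 'm) cat \<Rightarrow> 'o \<Rightarrow> 'o \<Rightarrow> 'o \<Rightarrow> 'o \<Rightarrow> 'm \<Rightarrow> 'm \<Rightarrow> 'm \<Rightarrow> bool" where
  "is_exponential C a b e p \<pi>\<^sub>1 \<pi>\<^sub>2 ev \<longleftrightarrow>
     e \<in> Obj C \<and> is_product C e a p \<pi>\<^sub>1 \<pi>\<^sub>2 \<and> ev \<in> Hom C p b \<and>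
     (\<forall>z\<in>Obj C. \<forall>q \<rho>\<^sub>1 \<rho>\<^sub>2. is_product C z a q \<rho>\<^sub>1 \<rho>\<^sub>2 \<longrightarrow>
        (\<forall>g\<in>Hom C q b.
           \<exists>!h. h \<in> Hom C z e \<and>
             (\<exists>k\<in>Hom C q p.
                Comp C q p e \<pi>\<^sub>1 k = Comp C q z e h \<rho>\<^sub>1 \<and>
                Comp C q p a \<pi>\<^sub>2 k = \<rho>\<^sub>2 \<and>
                Comp C q p b ev k = g)))"

definition cartesian_closed :: "('o, 'm) cat \<Rightarrow> bool" where
  "cartesian_closed C \<longleftrightarrow>
     category C \<and>
     (\<exists>t. is_terminal C t) \<and>
     (\<forall>a\<in>Obj C. \<forall>b\<in>Obj C. \<exists>p \<pi>\<^sub>1 \<pi>\<^sub>2. is_product C a b p \<pi>\<^sub>1 \<pi>\<^sub>2) \<and>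
     (\<forall>a\<in>Obj C. \<forall>b\<in>Obj C. \<exists>e p \<pi>\<^sub>1 \<pi>\<^sub>2 ev. is_exponential C a b e p \<pi>\<^sub>1 \<pi>\<^sub>2 ev)"

definition slice :: "('o, 'm) cat \<Rightarrow> 'o \<Rightarrow> ('o \<times> 'm, 'm) cat" where
  "slice C t = Cat
     {(a, p). a \<in> Obj C \<and> p \<in> Hom C a t}
     (\<lambda>(a, p) (b, q). {g \<in> Hom C a b. Comp C a b t q g = p})
     (\<lambda>(a, p). Id C a)
     (\<lambda>(a, p) (b, q) (c, r). Comp C a b c)"

definition locally_cartesian_closed :: "('o, 'm) cat \<Rightarrow> bool" where
  "locally_cartesian_closed C \<longleftrightarrow>
     category C \<and> (\<forall>t\<in>Obj C. cartesian_closed (slice C t))"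

section \<open>Quasi-measurable spaces\<close>

text \<open>A map from a set \<open>A\<close> to a set \<open>B\<close> is an element of \<open>A \<rightarrow>\<^sub>E B\<close>, and \<open>compose A g f\<close> is the
  composite of \<open>f\<close> and \<open>g\<close> on the domain \<open>A\<close> of \<open>f\<close>.\<close>

definition sample_space :: "'w set \<Rightarrow> ('w \<Rightarrow> 'w) set \<Rightarrow> bool" where
  "sample_space \<Omega> M \<longleftrightarrow>
     \<Omega> \<noteq> {} \<and> M \<subseteq> \<Omega> \<rightarrow>\<^sub>E \<Omega> \<and>
     (\<lambda>\<omega>\<in>\<Omega>. \<omega>) \<in> M \<and>
     (\<forall>c\<in>\<Omega>. (\<lambda>\<omega>\<in>\<Omega>. c) \<in> M) \<and>
     (\<forall>\<phi>\<in>M. \<forall>\<psi>\<in>M. compose \<Omega> \<phi> \<psi> \<in> M)"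

datatype ('w, 'x) qspace = QSpace (pts: "'x set") (rvs: "('w \<Rightarrow> 'x) set")

definition qm_space :: "'w set \<Rightarrow> ('w \<Rightarrow> 'w) set \<Rightarrow> ('w, 'x) qspace \<Rightarrow> bool" where
  "qm_space \<Omega> M X \<longleftrightarrow>
     rvs X \<subseteq> \<Omega> \<rightarrow>\<^sub>E pts X \<and>
     (\<forall>c\<in>pts X. (\<lambda>\<omega>\<in>\<Omega>. c) \<in> rvs X) \<and>
     (\<forall>\<xi>\<in>rvs X. \<forall>\<phi>\<in>M. compose \<Omega> \<xi> \<phi> \<in> rvs X)"

definition qm_maps :: "'w set \<Rightarrow> ('w, 'x) qspace \<Rightarrow> ('w, 'y) qspace \<Rightarrow> ('x \<Rightarrow> 'y) set" where
  "qm_maps \<Omega> X Y = {g \<in> pts X \<rightarrow>\<^sub>E pts Y. \<forall>\<xi>\<in>rvs X. compose \<Omega> g \<xi> \<in> rvs Y}"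

definition point_space :: "'w set \<Rightarrow> 'x \<Rightarrow> ('w, 'x) qspace" where
  "point_space \<Omega> a = QSpace {a} {\<lambda>\<omega>\<in>\<Omega>. a}"

text \<open>The category of those quasi-measurable spaces with points in the type \<open>'u\<close> whose underlying
  set belongs to \<open>S\<close>. The parameter \<open>S\<close> is for restricting to small sets: a type cannot be closed
  under the formation of function spaces, but its subsets of smaller cardinality can be.\<close>

definition qms_category ::
    "'w set \<Rightarrow> ('w \<Rightarrow> 'w) set \<Rightarrow> 'u set set \<Rightarrow> (('w, 'u) qspace, 'u \<Rightarrow> 'u) cat" where
  "qms_category \<Omega> M S = Cat
     {X. qm_space \<Omega> M X \<and> pts X \<in> S}
     (qm_maps \<Omega>)
     (\<lambda>X. \<lambda>x\<in>pts X. x)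
     (\<lambda>X Y Z g f. compose (pts X) g f)"

section \<open>The slice over a quasi-measurable space, across types\<close>

text \<open>The spaces below may have points in different types. An object over \<open>T\<close> is a pair of
  a space and its structure map to \<open>T\<close>.\<close>

type_synonym ('w, 'x, 't) over = "('w, 'x) qspace \<times> ('x \<Rightarrow> 't)"

definition over_objs ::
    "'w set \<Rightarrow> ('w \<Rightarrow> 'w) set \<Rightarrow> ('w, 't) qspace \<Rightarrow> ('w, 'x, 't) over set" where
  "over_objs \<Omega> M T = {(X, p). qm_space \<Omega> M X \<and> p \<in> qm_maps \<Omega> X T}"

definition over_maps ::
    "'w set \<Rightarrow> ('w, 'x, 't) over \<Rightarrow> ('w, 'y, 't) over \<Rightarrow> ('x \<Rightarrow> 'y) set" where
  "over_maps \<Omega> A B = {g \<in> qm_maps \<Omega> (fst A) (fst B). compose (pts (fst A)) (snd B) g = snd A}"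

abbreviation over_pts :: "('w, 'x, 't) over \<Rightarrow> 'x set" where
  "over_pts A \<equiv> pts (fst A)"

definition over_terminal :: "('w, 't) qspace \<Rightarrow> ('w, 't, 't) over" where
  "over_terminal T = (T, \<lambda>t\<in>pts T. t)"

definition over_prod_pts :: "('w, 'x, 't) over \<Rightarrow> ('w, 'y, 't) over \<Rightarrow> ('x \<times> 'y) set" where
  "over_prod_pts A B = {(x, y). x \<in> over_pts A \<and> y \<in> over_pts B \<and> snd A x = snd B y}"

text \<open>The product over \<open>T\<close> is the fibre product.\<close>

definition over_prod ::
    "'w set \<Rightarrow> ('w, 'x, 't) over \<Rightarrow> ('w, 'y, 't) over \<Rightarrow> ('w, 'x \<times> 'y, 't) over" where
  "over_prod \<Omega> A B =
     (QSpace (over_prod_pts A B)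
        {\<zeta> \<in> \<Omega> \<rightarrow>\<^sub>E over_prod_pts A B.
           (\<lambda>\<omega>\<in>\<Omega>. fst (\<zeta> \<omega>)) \<in> rvs (fst A) \<and> (\<lambda>\<omega>\<in>\<Omega>. snd (\<zeta> \<omega>)) \<in> rvs (fst B)},
      \<lambda>z\<in>over_prod_pts A B. snd A (fst z))"

definition fibre :: "'w set \<Rightarrow> ('w, 'x, 't) over \<Rightarrow> 't \<Rightarrow> ('w, 'x) qspace" where
  "fibre \<Omega> A t = QSpace {x \<in> over_pts A. snd A x = t}
     {\<xi> \<in> rvs (fst A). \<forall>\<omega>\<in>\<Omega>. snd A (\<xi> \<omega>) = t}"

definition over_exp_pts ::
    "'w set \<Rightarrow> ('w, 't) qspace \<Rightarrow> ('w, 'x, 't) over \<Rightarrow> ('w, 'y, 't) over \<Rightarrow> ('t \<times> ('x \<Rightarrow> 'y)) set" where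
  "over_exp_pts \<Omega> T A B =
     {(t, f). t \<in> pts T \<and> f \<in> qm_maps \<Omega> (fibre \<Omega> A t) (fibre \<Omega> B t)}"

text \<open>The exponential \<open>B\<^sup>A\<close> over \<open>T\<close>: its points over \<open>t\<close> are the quasi-measurable maps between the
  fibres over \<open>t\<close>. A map \<open>\<zeta>\<close> into it is admissible if its base component is, and if for every
  \<open>\<phi> \<in> M\<close> applying \<open>\<zeta> \<circ> \<phi>\<close> pointwise to an admissible map \<open>\<xi>\<close> into \<open>A\<close> lying over the same base
  points yields an admissible map into \<open>B\<close>.\<close>

definition over_exp ::
    "'w set \<Rightarrow> ('w \<Rightarrow> 'w) set \<Rightarrow> ('w, 't) qspace \<Rightarrow> ('w, 'x, 't) over \<Rightarrow> ('w, 'y, 't) over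
      \<Rightarrow> ('w, 't \<times> ('x \<Rightarrow> 'y), 't) over" where
  "over_exp \<Omega> M T A B =
     (QSpace (over_exp_pts \<Omega> T A B)
        {\<zeta> \<in> \<Omega> \<rightarrow>\<^sub>E over_exp_pts \<Omega> T A B.
           (\<lambda>\<omega>\<in>\<Omega>. fst (\<zeta> \<omega>)) \<in> rvs T \<and>
           (\<forall>\<phi>\<in>M. \<forall>\<xi>\<in>rvs (fst A).
              (\<forall>\<omega>\<in>\<Omega>. snd A (\<xi> \<omega>) = fst (\<zeta> (\<phi> \<omega>))) \<longrightarrow>
              (\<lambda>\<omega>\<in>\<Omega>. snd (\<zeta> (\<phi> \<omega>)) (\<xi> \<omega>)) \<in> rvs (fst B))},
      \<lambda>z\<in>over_exp_pts \<Omega> T A B. fst z)"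

definition over_eval ::
    "'w set \<Rightarrow> ('w \<Rightarrow> 'w) set \<Rightarrow> ('w, 't) qspace \<Rightarrow> ('w, 'x, 't) over \<Rightarrow> ('w, 'y, 't) over
      \<Rightarrow> ('t \<times> ('x \<Rightarrow> 'y)) \<times> 'x \<Rightarrow> 'y" where
  "over_eval \<Omega> M T A B =
     (\<lambda>((t, f), x)\<in>over_pts (over_prod \<Omega> (over_exp \<Omega> M T A B) A). f x)"

end

theory Submission
  imports Defs
begin

text \<open>A point of the exponential is a base point together with a map between the fibres over it, so
  currying works fibrewise. In the definition of the admissible maps into \<open>B\<^sup>A\<close>, quantifying over
  all \<open>\<phi> \<in> M\<close> gives stability under reparametrisation, and the instance \<open>\<phi> = id\<close> makes
  evaluation quasi-measurable. Over a strong limit, the fibre products and exponentials of small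
  spaces are small, hence isomorphic to spaces with points in the given type.\<close>

section \<open>Quasi-measurable maps over a base\<close>

text \<open>The test used to define admissible maps into \<open>B^A\<close> is met by every
  transpose. Given \<open>g\<close> on the fibre product of \<open>Z\<close> and \<open>A\<close>, a
  random variable \<open>\<zeta>\<close> of \<open>Z\<close> and some \<open>\<xi>\<close> of
  \<open>A\<close> over the same base points as \<open>\<zeta> \<circ> \<phi>\<close>, the pair of
  \<open>\<zeta> \<circ> \<phi>\<close> and \<open>\<xi>\<close> is a random variable of the fibre
  product, and \<open>g\<close> sends it to one of \<open>B\<close>. The obstacle is typing. All
  objects of one \<open>cat\<close> share a point type, while the points of \<open>B^A\<close> are
  pairs of a base point and a function. So the universal properties are first proved with
  independent point types for all spaces involved, and afterwards carried along bijections into a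
  single type. Smallness survives because an extensional fibre map is determined by its graph:
  \<open>B^A\<close> injects into the product of \<open>T\<close> with the power set of
  \<open>A \<times> B\<close>. The power set is the reason for asking for a strong limit.\<close>

declare compose_eq [simp]

text \<open>Equality in HOL also concerns arguments outside \<open>X\<close>. There both sides are
  \<open>undefined\<close>, so commuting triangles can be checked pointwise on
  \<open>X\<close>.\<close>

lemma compose_eq_iff:
  assumes "k \<in> extensional X"
  shows "compose X g f = k \<longleftrightarrow> (\<forall>x\<in>X. g (f x) = k x)"
proof
  show "\<forall>x\<in>X. g (f x) = k x" if "compose X g f = k"
    using that by auto
  show "compose X g f = k" if "\<forall>x\<in>X. g (f x) = k x"
    using that by (intro extensionalityI[OF compose_extensional assms]) simp
qed

lemma qm_space_rv_pt: "qm_space \<Omega> M X \<Longrightarrow> \<xi> \<in> rvs X \<Longrightarrow> \<omega> \<in> \<Omega> \<Longrightarrow> \<xi> \<omega> \<in> pts X"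
  unfolding qm_space_def by blast

lemma qm_space_rv_restrict: "qm_space \<Omega> M X \<Longrightarrow> \<xi> \<in> rvs X \<Longrightarrow> restrict \<xi> \<Omega> = \<xi>"
  unfolding qm_space_def by (auto simp: PiE_def intro!: extensional_restrict)

lemma qm_space_const: "qm_space \<Omega> M X \<Longrightarrow> c \<in> pts X \<Longrightarrow> (\<lambda>\<omega>\<in>\<Omega>. c) \<in> rvs X"
  unfolding qm_space_def by blast

lemma qm_space_reparam:
  "qm_space \<Omega> M X \<Longrightarrow> \<xi> \<in> rvs X \<Longrightarrow> \<phi> \<in> M \<Longrightarrow> (\<lambda>\<omega>\<in>\<Omega>. \<xi> (\<phi> \<omega>)) \<in> rvs X"
  unfolding qm_space_def compose_def by blast

lemma qm_map_pt: "g \<in> qm_maps \<Omega> X Y \<Longrightarrow> x \<in> pts X \<Longrightarrow> g x \<in> pts Y"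
  unfolding qm_maps_def by blast

lemma qm_map_rv: "g \<in> qm_maps \<Omega> X Y \<Longrightarrow> \<xi> \<in> rvs X \<Longrightarrow> (\<lambda>\<omega>\<in>\<Omega>. g (\<xi> \<omega>)) \<in> rvs Y"
  unfolding qm_maps_def compose_def by blast

lemma qm_map_extensional: "g \<in> qm_maps \<Omega> X Y \<Longrightarrow> g \<in> extensional (pts X)"
  unfolding qm_maps_def by (auto simp: PiE_def)

text \<open>The targets may differ, since extensionality refers to the domain alone.\<close>

lemma qm_map_eqI:
  "\<lbrakk>g \<in> qm_maps \<Omega> X Y; h \<in> qm_maps \<Omega> X Z; \<And>x. x \<in> pts X \<Longrightarrow> g x = h x\<rbrakk> \<Longrightarrow> g = h"
  by (meson extensionalityI qm_map_extensional)

text \<open>Random variables of \<open>X\<close> take values in \<open>pts X\<close>, so the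
  restriction disappears after composing with one. This lets quasi-measurability be checked on the
  unrestricted \<open>f\<close>.\<close>

lemma qm_map_restrict:
  assumes "qm_space \<Omega> M X" "\<And>x. x \<in> pts X \<Longrightarrow> f x \<in> pts Y"
    and "\<And>\<xi>. \<xi> \<in> rvs X \<Longrightarrow> (\<lambda>\<omega>\<in>\<Omega>. f (\<xi> \<omega>)) \<in> rvs Y"
  shows "restrict f (pts X) \<in> qm_maps \<Omega> X Y"
proof -
  have "compose \<Omega> (restrict f (pts X)) \<xi> = (\<lambda>\<omega>\<in>\<Omega>. f (\<xi> \<omega>))" if "\<xi> \<in> rvs X" for \<xi>
    unfolding compose_def using qm_space_rv_pt[OF assms(1) that] by (intro restrict_ext) simp
  then show ?thesis
    unfolding qm_maps_def using assms by auto
qed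

lemma qm_map_compose:
  assumes "qm_space \<Omega> M X" "f \<in> qm_maps \<Omega> X Y" "g \<in> qm_maps \<Omega> Y Z"
  shows "compose (pts X) g f \<in> qm_maps \<Omega> X Z"
  unfolding compose_def
proof (rule qm_map_restrict[OF assms(1)])
  show "g (f x) \<in> pts Z" if "x \<in> pts X" for x
    using assms that by (meson qm_map_pt)
  show "(\<lambda>\<omega>\<in>\<Omega>. g (f (\<xi> \<omega>))) \<in> rvs Z" if "\<xi> \<in> rvs X" for \<xi>
    using qm_map_rv[OF assms(3) qm_map_rv[OF assms(2) that]] by (simp cong: restrict_cong)
qed

lemma qm_map_id: "qm_space \<Omega> M X \<Longrightarrow> (\<lambda>x\<in>pts X. x) \<in> qm_maps \<Omega> X X"
  by (rule qm_map_restrict) (auto simp: qm_space_rv_restrict)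

section \<open>Objects and maps over a base space\<close>

lemma over_objs_iff:
  "A \<in> over_objs \<Omega> M T \<longleftrightarrow> qm_space \<Omega> M (fst A) \<and> snd A \<in> qm_maps \<Omega> (fst A) T"
  by (cases A) (simp add: over_objs_def)

lemma over_maps_iff:
  assumes "A \<in> over_objs \<Omega> M T"
  shows "g \<in> over_maps \<Omega> A B \<longleftrightarrow>
    g \<in> qm_maps \<Omega> (fst A) (fst B) \<and> (\<forall>x\<in>over_pts A. snd B (g x) = snd A x)"
proof -
  have ext: "snd A \<in> extensional (over_pts A)"
    using assms qm_map_extensional unfolding over_objs_iff by blast
  show ?thesis
    unfolding over_maps_def by (auto simp: compose_eq_iff[OF ext])
qed

lemma over_map_pt: "g \<in> over_maps \<Omega> A B \<Longrightarrow> x \<in> over_pts A \<Longrightarrow> g x \<in> over_pts B"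
  by (auto simp: over_maps_def intro: qm_map_pt)

lemma over_map_base: "g \<in> over_maps \<Omega> A B \<Longrightarrow> x \<in> over_pts A \<Longrightarrow> snd B (g x) = snd A x"
  unfolding over_maps_def by (auto dest: arg_cong[where f = "\<lambda>h. h x"])

lemma over_map_rv:
  "g \<in> over_maps \<Omega> A B \<Longrightarrow> \<xi> \<in> rvs (fst A) \<Longrightarrow> (\<lambda>\<omega>\<in>\<Omega>. g (\<xi> \<omega>)) \<in> rvs (fst B)"
  unfolding over_maps_def using qm_map_rv by blast

lemma over_map_eqI:
  "\<lbrakk>g \<in> over_maps \<Omega> A B; h \<in> over_maps \<Omega> A C; \<And>x. x \<in> over_pts A \<Longrightarrow> g x = h x\<rbrakk> \<Longrightarrow> g = h"
  unfolding over_maps_def by (auto intro: qm_map_eqI)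

lemma over_map_restrict:
  assumes "A \<in> over_objs \<Omega> M T" "\<And>x. x \<in> over_pts A \<Longrightarrow> f x \<in> over_pts B"
    and "\<And>x. x \<in> over_pts A \<Longrightarrow> snd B (f x) = snd A x"
    and "\<And>\<xi>. \<xi> \<in> rvs (fst A) \<Longrightarrow> (\<lambda>\<omega>\<in>\<Omega>. f (\<xi> \<omega>)) \<in> rvs (fst B)"
  shows "restrict f (over_pts A) \<in> over_maps \<Omega> A B"
  unfolding over_maps_iff[OF assms(1)]
  using assms by (auto simp: over_objs_iff intro!: qm_map_restrict)

lemma over_map_compose:
  assumes A: "A \<in> over_objs \<Omega> M T" and f: "f \<in> over_maps \<Omega> A B" and g: "g \<in> over_maps \<Omega> B C"
  shows "compose (over_pts A) g f \<in> over_maps \<Omega> A C"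
  unfolding compose_def
proof (rule over_map_restrict[OF A])
  show "(\<lambda>\<omega>\<in>\<Omega>. g (f (\<xi> \<omega>))) \<in> rvs (fst C)" if "\<xi> \<in> rvs (fst A)" for \<xi>
    using over_map_rv[OF g over_map_rv[OF f that]] by (simp cong: restrict_cong)
qed (use over_map_pt[OF f] over_map_pt[OF g] over_map_base[OF f] over_map_base[OF g] in auto)

lemma over_obj_rv_pt:
  "A \<in> over_objs \<Omega> M T \<Longrightarrow> \<xi> \<in> rvs (fst A) \<Longrightarrow> \<omega> \<in> \<Omega> \<Longrightarrow> \<xi> \<omega> \<in> over_pts A"
  by (auto simp: over_objs_iff intro: qm_space_rv_pt)

lemma over_obj_rv_restrict: "A \<in> over_objs \<Omega> M T \<Longrightarrow> \<xi> \<in> rvs (fst A) \<Longrightarrow> restrict \<xi> \<Omega> = \<xi>"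
  using qm_space_rv_restrict unfolding over_objs_iff by blast

lemma over_obj_base: "A \<in> over_objs \<Omega> M T \<Longrightarrow> x \<in> over_pts A \<Longrightarrow> snd A x \<in> pts T"
  by (auto simp: over_objs_iff intro: qm_map_pt)

lemma over_obj_base_rv:
  "A \<in> over_objs \<Omega> M T \<Longrightarrow> \<xi> \<in> rvs (fst A) \<Longrightarrow> (\<lambda>\<omega>\<in>\<Omega>. snd A (\<xi> \<omega>)) \<in> rvs T"
  using qm_map_rv unfolding over_objs_iff by blast

lemma over_obj_reparam:
  "A \<in> over_objs \<Omega> M T \<Longrightarrow> \<xi> \<in> rvs (fst A) \<Longrightarrow> \<phi> \<in> M \<Longrightarrow> (\<lambda>\<omega>\<in>\<Omega>. \<xi> (\<phi> \<omega>)) \<in> rvs (fst A)"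
  using qm_space_reparam unfolding over_objs_iff by blast

lemma sample_space_pt: "sample_space \<Omega> M \<Longrightarrow> \<phi> \<in> M \<Longrightarrow> \<omega> \<in> \<Omega> \<Longrightarrow> \<phi> \<omega> \<in> \<Omega>"
  unfolding sample_space_def by blast

section \<open>Terminal object and fibre products\<close>

lemma qm_space_point_space: "sample_space \<Omega> M \<Longrightarrow> qm_space \<Omega> M (point_space \<Omega> a)"
  unfolding qm_space_def point_space_def compose_def
  by (auto simp: sample_space_pt cong: restrict_cong)

lemma point_space_terminal:
  assumes "qm_space \<Omega> M Z"
  shows "\<exists>!h. h \<in> qm_maps \<Omega> Z (point_space \<Omega> a)"
proof (rule ex1I)
  show "(\<lambda>z\<in>pts Z. a) \<in> qm_maps \<Omega> Z (point_space \<Omega> a)"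
    using assms by (rule qm_map_restrict) (auto simp: point_space_def)
  then show "h = (\<lambda>z\<in>pts Z. a)" if "h \<in> qm_maps \<Omega> Z (point_space \<Omega> a)" for h
    using qm_map_pt[OF that] by (intro qm_map_eqI[OF that]) (auto simp: point_space_def)
qed

lemma over_terminal_obj: "qm_space \<Omega> M T \<Longrightarrow> over_terminal T \<in> over_objs \<Omega> M T"
  by (simp add: over_objs_iff over_terminal_def qm_map_id)

text \<open>The structure map of the terminal object is the identity of \<open>T\<close>, so the
  commuting triangle forces a map into it to be the structure map of \<open>Z\<close>.\<close>

lemma over_terminal_terminal:
  assumes Z: "Z \<in> over_objs \<Omega> M T"
  shows "\<exists>!h. h \<in> over_maps \<Omega> Z (over_terminal T)"
proof (rule ex1I)
  show base: "snd Z \<in> over_maps \<Omega> Z (over_terminal T)"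
    unfolding over_maps_iff[OF Z]
    using Z by (auto simp: over_objs_iff over_terminal_def qm_map_pt)
  show "h = snd Z" if h: "h \<in> over_maps \<Omega> Z (over_terminal T)" for h
    using over_map_pt[OF h] over_map_base[OF h]
    by (intro over_map_eqI[OF h base]) (auto simp: over_terminal_def)
qed

section \<open>Fibre products\<close>

lemma over_pts_prod [simp]: "over_pts (over_prod \<Omega> A B) = over_prod_pts A B"
  by (simp add: over_prod_def)

lemma over_prod_pts_iff:
  "z \<in> over_prod_pts A B \<longleftrightarrow>
    fst z \<in> over_pts A \<and> snd z \<in> over_pts B \<and> snd A (fst z) = snd B (snd z)"
  by (cases z) (simp add: over_prod_pts_def)

lemma over_prod_rv_iff:
  "\<zeta> \<in> rvs (fst (over_prod \<Omega> A B)) \<longleftrightarrow>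
    \<zeta> \<in> \<Omega> \<rightarrow>\<^sub>E over_prod_pts A B \<and>
    (\<lambda>\<omega>\<in>\<Omega>. fst (\<zeta> \<omega>)) \<in> rvs (fst A) \<and> (\<lambda>\<omega>\<in>\<Omega>. snd (\<zeta> \<omega>)) \<in> rvs (fst B)"
  by (simp add: over_prod_def)

lemma over_prod_base [simp]: "z \<in> over_prod_pts A B \<Longrightarrow> snd (over_prod \<Omega> A B) z = snd A (fst z)"
  by (simp add: over_prod_def)

text \<open>Besides pairing maps, this produces the random variables to which a map on a fibre
  product is applied when it is curried.\<close>

lemma over_prod_rv_pair:
  assumes A: "A \<in> over_objs \<Omega> M T" and B: "B \<in> over_objs \<Omega> M T"
    and \<xi>: "\<xi> \<in> rvs (fst A)" and \<eta>: "\<eta> \<in> rvs (fst B)"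
    and eq: "\<And>\<omega>. \<omega> \<in> \<Omega> \<Longrightarrow> snd A (\<xi> \<omega>) = snd B (\<eta> \<omega>)"
  shows "(\<lambda>\<omega>\<in>\<Omega>. (\<xi> \<omega>, \<eta> \<omega>)) \<in> rvs (fst (over_prod \<Omega> A B))"
  unfolding over_prod_rv_iff
  using over_obj_rv_pt[OF A \<xi>] over_obj_rv_pt[OF B \<eta>] eq \<xi> \<eta>
  by (auto simp: over_prod_pts_iff over_obj_rv_restrict[OF A] over_obj_rv_restrict[OF B]
      cong: restrict_cong)

lemma over_prod_obj:
  assumes ss: "sample_space \<Omega> M" and A: "A \<in> over_objs \<Omega> M T" and B: "B \<in> over_objs \<Omega> M T"
  shows "over_prod \<Omega> A B \<in> over_objs \<Omega> M T"
proof -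
  let ?P = "over_prod \<Omega> A B"
  have sp: "qm_space \<Omega> M (fst ?P)"
    unfolding qm_space_def
  proof (intro conjI ballI)
    show "rvs (fst ?P) \<subseteq> \<Omega> \<rightarrow>\<^sub>E over_pts ?P"
      by (auto simp: over_prod_rv_iff)
    show "(\<lambda>\<omega>\<in>\<Omega>. c) \<in> rvs (fst ?P)" if "c \<in> over_pts ?P" for c
      using that A B unfolding over_prod_rv_iff over_objs_iff
      by (auto simp: over_prod_pts_iff qm_space_const cong: restrict_cong)
    show "compose \<Omega> \<zeta> \<phi> \<in> rvs (fst ?P)" if \<zeta>: "\<zeta> \<in> rvs (fst ?P)" and \<phi>: "\<phi> \<in> M" for \<zeta> \<phi>
      using \<zeta> over_obj_reparam[OF A, of "\<lambda>\<omega>\<in>\<Omega>. fst (\<zeta> \<omega>)" \<phi>]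
        over_obj_reparam[OF B, of "\<lambda>\<omega>\<in>\<Omega>. snd (\<zeta> \<omega>)" \<phi>] \<phi> sample_space_pt[OF ss \<phi>]
      unfolding over_prod_rv_iff compose_def by (auto cong: restrict_cong)
  qed
  have "(\<lambda>z\<in>over_pts ?P. snd A (fst z)) \<in> qm_maps \<Omega> (fst ?P) T"
  proof (rule qm_map_restrict[OF sp])
    show "(\<lambda>\<omega>\<in>\<Omega>. snd A (fst (\<zeta> \<omega>))) \<in> rvs T" if "\<zeta> \<in> rvs (fst ?P)" for \<zeta>
      using that over_obj_base_rv[OF A, of "\<lambda>\<omega>\<in>\<Omega>. fst (\<zeta> \<omega>)"]
      by (simp add: over_prod_rv_iff cong: restrict_cong)
  \<comment> \<open>The base point may be computed from either component of a point of the fibre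
    product; here the one in \<open>B\<close> is used.\<close>
  qed (auto simp: over_prod_pts_iff intro: over_obj_base[OF B])
  with sp show ?thesis
    by (simp add: over_objs_iff) (simp add: over_prod_def)
qed

lemma over_prod_fst:
  assumes "sample_space \<Omega> M" "A \<in> over_objs \<Omega> M T" "B \<in> over_objs \<Omega> M T"
  shows "(\<lambda>z\<in>over_prod_pts A B. fst z) \<in> over_maps \<Omega> (over_prod \<Omega> A B) A"
  using over_map_restrict[OF over_prod_obj[OF assms], of fst A]
  by (simp add: over_prod_pts_iff over_prod_rv_iff)

lemma over_prod_snd:
  assumes "sample_space \<Omega> M" "A \<in> over_objs \<Omega> M T" "B \<in> over_objs \<Omega> M T"
  shows "(\<lambda>z\<in>over_prod_pts A B. snd z) \<in> over_maps \<Omega> (over_prod \<Omega> A B) B"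
  using over_map_restrict[OF over_prod_obj[OF assms], of snd B]
  by (simp add: over_prod_pts_iff over_prod_rv_iff)

lemma over_prod_pair:
  assumes A: "A \<in> over_objs \<Omega> M T" and B: "B \<in> over_objs \<Omega> M T" and Z: "Z \<in> over_objs \<Omega> M T"
    and f: "f \<in> over_maps \<Omega> Z A" and g: "g \<in> over_maps \<Omega> Z B"
  shows "(\<lambda>z\<in>over_pts Z. (f z, g z)) \<in> over_maps \<Omega> Z (over_prod \<Omega> A B)"
proof (rule over_map_restrict[OF Z])
  show "(\<lambda>\<omega>\<in>\<Omega>. (f (\<xi> \<omega>), g (\<xi> \<omega>))) \<in> rvs (fst (over_prod \<Omega> A B))"
    if "\<xi> \<in> rvs (fst Z)" for \<xi>
    using over_prod_rv_pair[OF A B over_map_rv[OF f that] over_map_rv[OF g that]]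
      over_obj_rv_pt[OF Z that] over_map_base[OF f] over_map_base[OF g]
    by (simp cong: restrict_cong)
qed (use over_map_pt[OF f] over_map_pt[OF g] over_map_base[OF f] over_map_base[OF g]
     in \<open>auto simp: over_prod_pts_iff\<close>)

lemma over_prod_universal:
  assumes ss: "sample_space \<Omega> M"
    and A: "A \<in> over_objs \<Omega> M T" and B: "B \<in> over_objs \<Omega> M T" and Z: "Z \<in> over_objs \<Omega> M T"
    and f: "f \<in> over_maps \<Omega> Z A" and g: "g \<in> over_maps \<Omega> Z B"
  shows "\<exists>!h. h \<in> over_maps \<Omega> Z (over_prod \<Omega> A B) \<and>
      compose (over_pts Z) (\<lambda>z\<in>over_prod_pts A B. fst z) h = f \<and>
      compose (over_pts Z) (\<lambda>z\<in>over_prod_pts A B. snd z) h = g"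
    (is "\<exists>!h. ?Q h")
proof (rule ex1I)
  let ?h = "\<lambda>z\<in>over_pts Z. (f z, g z)"
  note pair = over_prod_pair[OF A B Z f g]
  note fst_h = over_map_compose[OF Z pair over_prod_fst[OF ss A B]]
    and snd_h = over_map_compose[OF Z pair over_prod_snd[OF ss A B]]
  show "?Q ?h"
    using pair over_map_eqI[OF fst_h f] over_map_eqI[OF snd_h g] over_map_pt[OF pair] by auto
  show "h = ?h" if "?Q h" for h
  proof (rule over_map_eqI)
    show "h \<in> over_maps \<Omega> Z (over_prod \<Omega> A B)"
      using that by blast
    show "h z = ?h z" if z: "z \<in> over_pts Z" for z
      using \<open>?Q h\<close> z over_map_pt[of h \<Omega> Z "over_prod \<Omega> A B" z] by (auto simp: prod_eq_iff)
  qed (rule pair)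
qed

section \<open>Exponentials\<close>

lemma fibre_pts [simp]: "pts (fibre \<Omega> A t) = {x \<in> over_pts A. snd A x = t}"
  by (simp add: fibre_def)

lemma fibre_rv_iff: "\<xi> \<in> rvs (fibre \<Omega> A t) \<longleftrightarrow> \<xi> \<in> rvs (fst A) \<and> (\<forall>\<omega>\<in>\<Omega>. snd A (\<xi> \<omega>) = t)"
  by (simp add: fibre_def)

lemma qm_space_fibre:
  assumes ss: "sample_space \<Omega> M" and A: "A \<in> over_objs \<Omega> M T"
  shows "qm_space \<Omega> M (fibre \<Omega> A t)"
  unfolding qm_space_def
proof (intro conjI ballI subsetI)
  show "\<xi> \<in> \<Omega> \<rightarrow>\<^sub>E pts (fibre \<Omega> A t)" if "\<xi> \<in> rvs (fibre \<Omega> A t)" for \<xi>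
    using that over_obj_rv_pt[OF A] over_obj_rv_restrict[OF A, of \<xi>]
    by (auto simp: fibre_rv_iff PiE_iff) (metis restrict_extensional)
  show "(\<lambda>\<omega>\<in>\<Omega>. c) \<in> rvs (fibre \<Omega> A t)" if "c \<in> pts (fibre \<Omega> A t)" for c
    using that A by (auto simp: fibre_rv_iff over_objs_iff qm_space_const)
  show "compose \<Omega> \<xi> \<phi> \<in> rvs (fibre \<Omega> A t)" if "\<xi> \<in> rvs (fibre \<Omega> A t)" "\<phi> \<in> M" for \<xi> \<phi>
    using that over_obj_reparam[OF A] sample_space_pt[OF ss]
    by (auto simp: fibre_rv_iff compose_def)
qed

section \<open>The exponential object and its evaluation\<close>

lemma over_pts_exp [simp]: "over_pts (over_exp \<Omega> M T A B) = over_exp_pts \<Omega> T A B"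
  by (simp add: over_exp_def)

lemma over_exp_pts_iff:
  "z \<in> over_exp_pts \<Omega> T A B \<longleftrightarrow>
    fst z \<in> pts T \<and> snd z \<in> qm_maps \<Omega> (fibre \<Omega> A (fst z)) (fibre \<Omega> B (fst z))"
  by (cases z) (simp add: over_exp_pts_def)

lemma over_exp_rv_iff:
  "\<zeta> \<in> rvs (fst (over_exp \<Omega> M T A B)) \<longleftrightarrow>
    \<zeta> \<in> \<Omega> \<rightarrow>\<^sub>E over_exp_pts \<Omega> T A B \<and>
    (\<lambda>\<omega>\<in>\<Omega>. fst (\<zeta> \<omega>)) \<in> rvs T \<and>
    (\<forall>\<phi>\<in>M. \<forall>\<xi>\<in>rvs (fst A).
       (\<forall>\<omega>\<in>\<Omega>. snd A (\<xi> \<omega>) = fst (\<zeta> (\<phi> \<omega>))) \<longrightarrow>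
       (\<lambda>\<omega>\<in>\<Omega>. snd (\<zeta> (\<phi> \<omega>)) (\<xi> \<omega>)) \<in> rvs (fst B))"
  by (simp add: over_exp_def)

lemma over_exp_base [simp]:
  "z \<in> over_exp_pts \<Omega> T A B \<Longrightarrow> snd (over_exp \<Omega> M T A B) z = fst z"
  by (simp add: over_exp_def)

lemma over_exp_obj:
  assumes ss: "sample_space \<Omega> M" and T: "qm_space \<Omega> M T"
    and A: "A \<in> over_objs \<Omega> M T" and B: "B \<in> over_objs \<Omega> M T"
  shows "over_exp \<Omega> M T A B \<in> over_objs \<Omega> M T"
proof -
  let ?E = "over_exp \<Omega> M T A B"
  have sp: "qm_space \<Omega> M (fst ?E)"
    unfolding qm_space_def
  proof (intro conjI ballI)
    show "rvs (fst ?E) \<subseteq> \<Omega> \<rightarrow>\<^sub>E over_pts ?E"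
      by (auto simp: over_exp_rv_iff)
    show "(\<lambda>\<omega>\<in>\<Omega>. c) \<in> rvs (fst ?E)" if c: "c \<in> over_pts ?E" for c
    proof -
      \<comment> \<open>A random variable of \<open>A\<close> lying over the single base point
        \<open>fst c\<close> is a random variable of that fibre, on which \<open>snd c\<close> is
        quasi-measurable.\<close>
      have "(\<lambda>\<omega>\<in>\<Omega>. snd c (\<xi> \<omega>)) \<in> rvs (fst B)"
        if "\<xi> \<in> rvs (fst A)" "\<forall>\<omega>\<in>\<Omega>. snd A (\<xi> \<omega>) = fst c" for \<xi>
        using qm_map_rv[of "snd c" \<Omega> "fibre \<Omega> A (fst c)" "fibre \<Omega> B (fst c)" \<xi>] that c
        by (simp add: over_exp_pts_iff fibre_rv_iff)
      then show ?thesis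
        using c T sample_space_pt[OF ss]
        by (auto simp: over_exp_rv_iff over_exp_pts_iff qm_space_const cong: restrict_cong)
    qed
    show "compose \<Omega> \<zeta> \<phi> \<in> rvs (fst ?E)" if \<zeta>: "\<zeta> \<in> rvs (fst ?E)" and \<phi>: "\<phi> \<in> M" for \<zeta> \<phi>
      unfolding over_exp_rv_iff
    proof (intro conjI ballI impI)
      show "compose \<Omega> \<zeta> \<phi> \<in> \<Omega> \<rightarrow>\<^sub>E over_exp_pts \<Omega> T A B"
        using \<zeta> sample_space_pt[OF ss \<phi>] by (auto simp: over_exp_rv_iff compose_def)
      show "(\<lambda>\<omega>\<in>\<Omega>. fst (compose \<Omega> \<zeta> \<phi> \<omega>)) \<in> rvs T"
        using qm_space_reparam[OF T, of "\<lambda>\<omega>\<in>\<Omega>. fst (\<zeta> \<omega>)" \<phi>] \<zeta> \<phi> sample_space_pt[OF ss \<phi>]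
        by (simp add: over_exp_rv_iff cong: restrict_cong)
      fix \<psi> \<xi>
      assume \<psi>: "\<psi> \<in> M" and \<xi>: "\<xi> \<in> rvs (fst A)"
        and eq: "\<forall>\<omega>\<in>\<Omega>. snd A (\<xi> \<omega>) = fst (compose \<Omega> \<zeta> \<phi> (\<psi> \<omega>))"
      \<comment> \<open>The test of \<open>\<zeta> \<circ> \<phi>\<close> at \<open>\<psi>\<close>
        is the test of \<open>\<zeta>\<close> at \<open>\<phi> \<circ> \<psi>\<close>.\<close>
      have comp: "compose \<Omega> \<phi> \<psi> \<in> M"
        using ss \<phi> \<psi> by (simp add: sample_space_def)
      have "\<forall>\<omega>\<in>\<Omega>. snd A (\<xi> \<omega>) = fst (\<zeta> (compose \<Omega> \<phi> \<psi> \<omega>))"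
        using eq sample_space_pt[OF ss \<psi>] by simp
      then have "(\<lambda>\<omega>\<in>\<Omega>. snd (\<zeta> (compose \<Omega> \<phi> \<psi> \<omega>)) (\<xi> \<omega>)) \<in> rvs (fst B)"
        using \<zeta> comp \<xi> unfolding over_exp_rv_iff by blast
      then show "(\<lambda>\<omega>\<in>\<Omega>. snd (compose \<Omega> \<zeta> \<phi> (\<psi> \<omega>)) (\<xi> \<omega>)) \<in> rvs (fst B)"
        using sample_space_pt[OF ss \<psi>] by (simp cong: restrict_cong)
    qed
  qed
  have "(\<lambda>z\<in>over_pts ?E. fst z) \<in> qm_maps \<Omega> (fst ?E) T"
    by (rule qm_map_restrict[OF sp]) (simp_all add: over_exp_pts_iff over_exp_rv_iff)
  with sp show ?thesis
    by (simp add: over_objs_iff) (simp add: over_exp_def)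
qed

lemma over_eval_apply [simp]:
  "(e, x) \<in> over_prod_pts (over_exp \<Omega> M T A B) A \<Longrightarrow> over_eval \<Omega> M T A B (e, x) = snd e x"
  by (cases e) (simp add: over_eval_def)

lemma over_eval_map:
  assumes ss: "sample_space \<Omega> M" and T: "qm_space \<Omega> M T"
    and A: "A \<in> over_objs \<Omega> M T" and B: "B \<in> over_objs \<Omega> M T"
  shows "over_eval \<Omega> M T A B \<in> over_maps \<Omega> (over_prod \<Omega> (over_exp \<Omega> M T A B) A) B"
proof -
  let ?E = "over_exp \<Omega> M T A B"
  let ?P = "over_prod \<Omega> ?E A"
  have val: "snd (fst z) (snd z) \<in> over_pts B \<and> snd B (snd (fst z) (snd z)) = fst (fst z)"
    if "z \<in> over_prod_pts ?E A" for z
    using that qm_map_pt[of "snd (fst z)" \<Omega> "fibre \<Omega> A (fst (fst z))" "fibre \<Omega> B (fst (fst z))"]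
    by (auto simp: over_prod_pts_iff over_exp_pts_iff)
  have "(\<lambda>z\<in>over_pts ?P. snd (fst z) (snd z)) \<in> over_maps \<Omega> ?P B"
  proof (rule over_map_restrict[OF over_prod_obj[OF ss over_exp_obj[OF ss T A B] A]])
    fix \<zeta> assume \<zeta>: "\<zeta> \<in> rvs (fst ?P)"
    have "(\<lambda>\<omega>\<in>\<Omega>. \<omega>) \<in> M"
      using ss by (simp add: sample_space_def)
    \<comment> \<open>The second component of \<open>\<zeta>\<close> serves as the test variable
      \<open>\<xi>\<close>; this is the required agreement of base points.\<close>
    moreover have "\<forall>\<omega>\<in>\<Omega>. snd A (snd (\<zeta> \<omega>)) = fst (fst (\<zeta> \<omega>))"
    proof
      fix \<omega> assume "\<omega> \<in> \<Omega>"
      then have "\<zeta> \<omega> \<in> over_prod_pts ?E A"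
        using \<zeta> by (auto simp: over_prod_rv_iff)
      then show "snd A (snd (\<zeta> \<omega>)) = fst (fst (\<zeta> \<omega>))"
        by (metis over_prod_pts_iff over_pts_exp over_exp_base)
    qed
    ultimately show "(\<lambda>\<omega>\<in>\<Omega>. snd (fst (\<zeta> \<omega>)) (snd (\<zeta> \<omega>))) \<in> rvs (fst B)"
      using \<zeta> unfolding over_prod_rv_iff over_exp_rv_iff
      by (auto dest!: bspec[where x = "\<lambda>\<omega>\<in>\<Omega>. \<omega>"] bspec[where x = "\<lambda>\<omega>\<in>\<Omega>. snd (\<zeta> \<omega>)"]
          cong: restrict_cong)
  qed (use val in \<open>auto simp: over_prod_pts_iff\<close>)
  moreover have "over_eval \<Omega> M T A B = (\<lambda>z\<in>over_pts ?P. snd (fst z) (snd z))"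
    unfolding over_eval_def by (intro restrict_ext) auto
  ultimately show ?thesis by simp
qed

text \<open>The arrow \<open>h \<times> id\<close> over \<open>T\<close>. Its body repeats the
  lambda term in the exponential clause of the theorem, so that term can be folded into this
  constant.\<close>

definition times_id ::
    "('w, 'x, 't) over \<Rightarrow> ('w, 'a, 't) over \<Rightarrow> ('x \<Rightarrow> 'y) \<Rightarrow> 'x \<times> 'a \<Rightarrow> 'y \<times> 'a" where
  "times_id Z A h = (\<lambda>(z, x)\<in>over_prod_pts Z A. (h z, x))"

lemma times_id_apply [simp]:
  "z \<in> over_prod_pts Z A \<Longrightarrow> times_id Z A h z = (h (fst z), snd z)"
  by (cases z) (simp add: times_id_def)

text \<open>\<open>times_id Z A h\<close> is the pairing of \<open>h\<close> after the first
  projection with the second projection, so the pairing lemma for fibre products applies.\<close>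

lemma times_id_map:
  assumes ss: "sample_space \<Omega> M" and Z: "Z \<in> over_objs \<Omega> M T" and A: "A \<in> over_objs \<Omega> M T"
    and E: "E \<in> over_objs \<Omega> M T" and h: "h \<in> over_maps \<Omega> Z E"
  shows "times_id Z A h \<in> over_maps \<Omega> (over_prod \<Omega> Z A) (over_prod \<Omega> E A)"
proof -
  note P = over_prod_obj[OF ss Z A]
  have "times_id Z A h = (\<lambda>z\<in>over_pts (over_prod \<Omega> Z A).
      (compose (over_pts (over_prod \<Omega> Z A)) h (\<lambda>z\<in>over_prod_pts Z A. fst z) z,
       (\<lambda>z\<in>over_prod_pts Z A. snd z) z))"
    by (auto simp: times_id_def fun_eq_iff)
  then show ?thesis
    using over_prod_pair[OF E A P over_map_compose[OF P over_prod_fst[OF ss Z A] h]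
        over_prod_snd[OF ss Z A]]
    by simp
qed

text \<open>The transpose is forced: compatibility with the base fixes the first component of
  \<open>h z\<close> as \<open>snd Z z\<close>, and each \<open>x\<close> in the fibre over it gives
  a point \<open>(z, x)\<close> at which the evaluation equation reads off the value of the second
  component. Extensionality settles the remaining arguments.\<close>

lemma over_exp_universal:
  assumes ss: "sample_space \<Omega> M" and T: "qm_space \<Omega> M T"
    and A: "A \<in> over_objs \<Omega> M T" and B: "B \<in> over_objs \<Omega> M T" and Z: "Z \<in> over_objs \<Omega> M T"
    and g: "g \<in> over_maps \<Omega> (over_prod \<Omega> Z A) B"
  shows "\<exists>!h. h \<in> over_maps \<Omega> Z (over_exp \<Omega> M T A B) \<and>
      compose (over_prod_pts Z A) (over_eval \<Omega> M T A B) (times_id Z A h) = g"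
    (is "\<exists>!h. ?Q h")
proof (rule ex1I)
  let ?E = "over_exp \<Omega> M T A B"
  let ?h = "\<lambda>z\<in>over_pts Z. (snd Z z, \<lambda>x\<in>pts (fibre \<Omega> A (snd Z z)). g (z, x))"
  note E = over_exp_obj[OF ss T A B]
  have g_fibre: "(\<lambda>x\<in>pts (fibre \<Omega> A (snd Z z)). g (z, x))
      \<in> qm_maps \<Omega> (fibre \<Omega> A (snd Z z)) (fibre \<Omega> B (snd Z z))" if z: "z \<in> over_pts Z" for z
  proof (rule qm_map_restrict[OF qm_space_fibre[OF ss A]])
    show "g (z, x) \<in> pts (fibre \<Omega> B (snd Z z))" if "x \<in> pts (fibre \<Omega> A (snd Z z))" for x
      using that z over_map_pt[OF g, of "(z, x)"] over_map_base[OF g, of "(z, x)"]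
      by (simp add: over_prod_pts_iff)
    fix \<xi> assume \<xi>: "\<xi> \<in> rvs (fibre \<Omega> A (snd Z z))"
    \<comment> \<open>Pair \<open>\<xi>\<close> with the constant random variable at
      \<open>z\<close>. The redex is kept so that the term matches
      \<open>over_prod_rv_pair\<close>.\<close>
    have "(\<lambda>\<omega>\<in>\<Omega>. ((\<lambda>\<omega>\<in>\<Omega>. z) \<omega>, \<xi> \<omega>)) \<in> rvs (fst (over_prod \<Omega> Z A))"
      using \<xi> z Z qm_space_const[of \<Omega> M "fst Z" z]
      by (intro over_prod_rv_pair[OF Z A, where \<xi> = "\<lambda>\<omega>\<in>\<Omega>. z"])
        (simp_all add: fibre_rv_iff over_objs_iff)
    from over_map_rv[OF g this] have "(\<lambda>\<omega>\<in>\<Omega>. g (z, \<xi> \<omega>)) \<in> rvs (fst B)"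
      by (simp cong: restrict_cong)
    moreover have "snd B (g (z, \<xi> \<omega>)) = snd Z z" if "\<omega> \<in> \<Omega>" for \<omega>
      using \<xi> that z over_obj_rv_pt[OF A, of \<xi> \<omega>] over_map_base[OF g, of "(z, \<xi> \<omega>)"]
      by (simp add: over_prod_pts_iff fibre_rv_iff)
    ultimately show "(\<lambda>\<omega>\<in>\<Omega>. g (z, \<xi> \<omega>)) \<in> rvs (fibre \<Omega> B (snd Z z))"
      by (simp add: fibre_rv_iff)
  qed
  then have h_pt: "(snd Z z, \<lambda>x\<in>pts (fibre \<Omega> A (snd Z z)). g (z, x)) \<in> over_exp_pts \<Omega> T A B"
    if "z \<in> over_pts Z" for z
    using that over_obj_base[OF Z that] by (simp add: over_exp_pts_iff)
  have h: "?h \<in> over_maps \<Omega> Z ?E"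
  proof (rule over_map_restrict[OF Z])
    fix \<zeta> assume \<zeta>: "\<zeta> \<in> rvs (fst Z)"
    note \<zeta>_pt = over_obj_rv_pt[OF Z \<zeta>]
    show "(\<lambda>\<omega>\<in>\<Omega>. (snd Z (\<zeta> \<omega>), \<lambda>x\<in>pts (fibre \<Omega> A (snd Z (\<zeta> \<omega>))). g (\<zeta> \<omega>, x)))
        \<in> rvs (fst ?E)"
      (is "restrict ?\<eta> \<Omega> \<in> _")
      unfolding over_exp_rv_iff
    proof (intro conjI ballI impI)
      show "restrict ?\<eta> \<Omega> \<in> \<Omega> \<rightarrow>\<^sub>E over_exp_pts \<Omega> T A B"
        using h_pt \<zeta>_pt by auto
      show "(\<lambda>\<omega>\<in>\<Omega>. fst (restrict ?\<eta> \<Omega> \<omega>)) \<in> rvs T"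
        using over_obj_base_rv[OF Z \<zeta>] by (simp cong: restrict_cong)
      fix \<phi> \<xi>
      assume \<phi>: "\<phi> \<in> M" and \<xi>: "\<xi> \<in> rvs (fst A)"
        and eq: "\<forall>\<omega>\<in>\<Omega>. snd A (\<xi> \<omega>) = fst (restrict ?\<eta> \<Omega> (\<phi> \<omega>))"
      have eq': "snd A (\<xi> \<omega>) = snd Z (\<zeta> (\<phi> \<omega>))" if "\<omega> \<in> \<Omega>" for \<omega>
        using eq that sample_space_pt[OF ss \<phi>] by simp
      \<comment> \<open>\<open>\<zeta> \<circ> \<phi>\<close> is a random variable of
        \<open>Z\<close> over the same base points as \<open>\<xi>\<close>, so \<open>g\<close> can
        be applied to the pair.\<close>
      then have "(\<lambda>\<omega>\<in>\<Omega>. ((\<lambda>\<omega>\<in>\<Omega>. \<zeta> (\<phi> \<omega>)) \<omega>, \<xi> \<omega>)) \<in> rvs (fst (over_prod \<Omega> Z A))"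
        by (intro over_prod_rv_pair[OF Z A over_obj_reparam[OF Z \<zeta> \<phi>] \<xi>]) simp
      from over_map_rv[OF g this]
      have "(\<lambda>\<omega>\<in>\<Omega>. g (\<zeta> (\<phi> \<omega>), \<xi> \<omega>)) \<in> rvs (fst B)"
        by (simp cong: restrict_cong)
      then show "(\<lambda>\<omega>\<in>\<Omega>. snd (restrict ?\<eta> \<Omega> (\<phi> \<omega>)) (\<xi> \<omega>)) \<in> rvs (fst B)"
        using sample_space_pt[OF ss \<phi>] over_obj_rv_pt[OF A \<xi>] eq'
        by (simp cong: restrict_cong)
    qed
  qed (use h_pt in auto)
  have ev: "compose (over_prod_pts Z A) (over_eval \<Omega> M T A B) (times_id Z A k)
      \<in> over_maps \<Omega> (over_prod \<Omega> Z A) B" if "k \<in> over_maps \<Omega> Z ?E" for k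
    using over_map_compose[OF over_prod_obj[OF ss Z A] times_id_map[OF ss Z A E that]
        over_eval_map[OF ss T A B]]
    by simp
  \<comment> \<open>That \<open>times_id Z A k\<close> maps into the fibre product places
    \<open>(k z, x)\<close> in the domain of the evaluation.\<close>
  have ev_apply: "over_eval \<Omega> M T A B (k z, x) = snd (k z) x"
    if "k \<in> over_maps \<Omega> Z ?E" "(z, x) \<in> over_prod_pts Z A" for k z x
    using over_map_pt[OF times_id_map[OF ss Z A E that(1)], of "(z, x)"] that(2) by simp
  have "compose (over_prod_pts Z A) (over_eval \<Omega> M T A B) (times_id Z A ?h) = g"
  proof (rule over_map_eqI[OF ev[OF h] g])
    show "compose (over_prod_pts Z A) (over_eval \<Omega> M T A B) (times_id Z A ?h) p = g p"
      if "p \<in> over_pts (over_prod \<Omega> Z A)" for p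
      using that ev_apply[OF h, of "fst p" "snd p"] by (simp add: over_prod_pts_iff)
  qed
  with h show "?Q ?h" by blast
  show "k = ?h" if k: "?Q k" for k
  proof (rule over_map_eqI[OF _ h])
    show kmap: "k \<in> over_maps \<Omega> Z ?E" using k by blast
    fix z assume z: "z \<in> over_pts Z"
    have kz: "k z \<in> over_exp_pts \<Omega> T A B"
      using over_map_pt[OF kmap z] by simp
    then have fst_k: "fst (k z) = snd Z z"
      using over_map_base[OF kmap z] by simp
    have "snd (k z) = (\<lambda>x\<in>pts (fibre \<Omega> A (snd Z z)). g (z, x))"
    proof (rule qm_map_eqI[OF _ g_fibre[OF z]])
      show "snd (k z) \<in> qm_maps \<Omega> (fibre \<Omega> A (snd Z z)) (fibre \<Omega> B (snd Z z))"
        using kz fst_k by (simp add: over_exp_pts_iff)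
      fix x assume x: "x \<in> pts (fibre \<Omega> A (snd Z z))"
      then have zx: "(z, x) \<in> over_prod_pts Z A"
        using z by (simp add: over_prod_pts_iff)
      have "g (z, x) = over_eval \<Omega> M T A B (k z, x)"
        using k zx by (auto dest: arg_cong[where f = "\<lambda>h. h (z, x)"])
      then show "snd (k z) x = (\<lambda>x\<in>pts (fibre \<Omega> A (snd Z z)). g (z, x)) x"
        using x ev_apply[OF kmap zx] by simp
    qed
    then show "k z = ?h z"
      using z fst_k by (simp add: prod_eq_iff)
  qed
qed

section \<open>Categories and slices\<close>

lemma category_id: "category C \<Longrightarrow> a \<in> Obj C \<Longrightarrow> Id C a \<in> Hom C a a"
  unfolding category_def by blast

lemma category_comp:
  "\<lbrakk>category C; a \<in> Obj C; b \<in> Obj C; c \<in> Obj C; f \<in> Hom C a b; g \<in> Hom C b c\<rbrakk>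
    \<Longrightarrow> Comp C a b c g f \<in> Hom C a c"
  unfolding category_def by blast

lemma category_unit:
  assumes "category C" "a \<in> Obj C" "b \<in> Obj C" "f \<in> Hom C a b"
  shows "Comp C a a b f (Id C a) = f" "Comp C a b b (Id C b) f = f"
  using assms unfolding category_def by blast+

lemma category_assoc:
  "\<lbrakk>category C; a \<in> Obj C; b \<in> Obj C; c \<in> Obj C; d \<in> Obj C;
    f \<in> Hom C a b; g \<in> Hom C b c; h \<in> Hom C c d\<rbrakk>
    \<Longrightarrow> Comp C a c d h (Comp C a b c g f) = Comp C a b d (Comp C b c d h g) f"
  unfolding category_def by blast

lemma category_slice:
  assumes C: "category C" and t: "t \<in> Obj C"
  shows "category (slice C t)"
  unfolding category_def slice_def
  using t category_id[OF C] category_comp[OF C] category_unit[OF C] category_assoc[OF C]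
  by (auto split: prod.splits)

lemma is_productD:
  assumes "is_product C a b p \<pi>\<^sub>1 \<pi>\<^sub>2"
  shows "p \<in> Obj C" "\<pi>\<^sub>1 \<in> Hom C p a" "\<pi>\<^sub>2 \<in> Hom C p b"
    and "\<lbrakk>z \<in> Obj C; f \<in> Hom C z a; g \<in> Hom C z b\<rbrakk>
      \<Longrightarrow> \<exists>!h. h \<in> Hom C z p \<and> Comp C z p a \<pi>\<^sub>1 h = f \<and> Comp C z p b \<pi>\<^sub>2 h = g"
  using assms unfolding is_product_def by blast+

text \<open>Since products are unique up to isomorphism, the universal property of an exponential need
  only be verified on one product \<open>z \<times> a\<close> for each \<open>z\<close>.\<close>

lemma is_exponentialI:
  assumes C: "category C" and a: "a \<in> Obj C" and b: "b \<in> Obj C" and e: "e \<in> Obj C"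
    and p: "is_product C e a p \<pi>\<^sub>1 \<pi>\<^sub>2" and ev: "ev \<in> Hom C p b"
    and univ: "\<And>z. z \<in> Obj C \<Longrightarrow> \<exists>q \<rho>\<^sub>1 \<rho>\<^sub>2. is_product C z a q \<rho>\<^sub>1 \<rho>\<^sub>2 \<and>
      (\<forall>g\<in>Hom C q b. \<exists>!h. h \<in> Hom C z e \<and>
         (\<exists>k\<in>Hom C q p. Comp C q p e \<pi>\<^sub>1 k = Comp C q z e h \<rho>\<^sub>1 \<and>
            Comp C q p a \<pi>\<^sub>2 k = \<rho>\<^sub>2 \<and> Comp C q p b ev k = g))"
  shows "is_exponential C a b e p \<pi>\<^sub>1 \<pi>\<^sub>2 ev"
  unfolding is_exponential_def
proof (intro conjI ballI allI impI)
  fix z q \<rho>\<^sub>1 \<rho>\<^sub>2 g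
  assume z: "z \<in> Obj C" and q: "is_product C z a q \<rho>\<^sub>1 \<rho>\<^sub>2" and g: "g \<in> Hom C q b"
  \<comment> \<open>\<open>Q\<close> expresses that \<open>ev\<close> after
    \<open>h \<times> id\<close> is \<open>g\<close>, with the product of \<open>z\<close> and
    \<open>a\<close> as a parameter so that two such products can be compared.\<close>
  define Q where "Q q \<rho>\<^sub>1 \<rho>\<^sub>2 g h \<longleftrightarrow>
    (\<exists>k\<in>Hom C q p. Comp C q p e \<pi>\<^sub>1 k = Comp C q z e h \<rho>\<^sub>1 \<and>
       Comp C q p a \<pi>\<^sub>2 k = \<rho>\<^sub>2 \<and> Comp C q p b ev k = g)" for q \<rho>\<^sub>1 \<rho>\<^sub>2 g h
  obtain r \<sigma>\<^sub>1 \<sigma>\<^sub>2 where r: "is_product C z a r \<sigma>\<^sub>1 \<sigma>\<^sub>2"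
    and univ_r: "\<And>g. g \<in> Hom C r b \<Longrightarrow> \<exists>!h. h \<in> Hom C z e \<and> Q r \<sigma>\<^sub>1 \<sigma>\<^sub>2 g h"
    using univ[OF z] unfolding Q_def by (elim exE conjE) simp
  note p' = is_productD[OF p] and q' = is_productD[OF q] and r' = is_productD[OF r]
  note assoc = category_assoc[OF C] and comp = category_comp[OF C]
  \<comment> \<open>If \<open>n\<close> respects the projections, then composing the witness
    \<open>k\<close> with \<open>n\<close> gives a witness over \<open>r'\<close> for the same
    \<open>h\<close>.\<close>
  have Q_pull: "Q r' \<tau>\<^sub>1 \<tau>\<^sub>2 (Comp C r' q' b g' n) h"
    if Q: "Q q' \<rho>\<^sub>1' \<rho>\<^sub>2' g' h" and h: "h \<in> Hom C z e"
      and obj: "q' \<in> Obj C" "r' \<in> Obj C" and n: "n \<in> Hom C r' q'"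
      and \<rho>: "\<rho>\<^sub>1' \<in> Hom C q' z"
      and \<tau>: "Comp C r' q' z \<rho>\<^sub>1' n = \<tau>\<^sub>1" "Comp C r' q' a \<rho>\<^sub>2' n = \<tau>\<^sub>2"
    for q' \<rho>\<^sub>1' \<rho>\<^sub>2' r' \<tau>\<^sub>1 \<tau>\<^sub>2 g' h n
  proof -
    obtain k where k: "k \<in> Hom C q' p" "Comp C q' p e \<pi>\<^sub>1 k = Comp C q' z e h \<rho>\<^sub>1'"
        "Comp C q' p a \<pi>\<^sub>2 k = \<rho>\<^sub>2'" "Comp C q' p b ev k = g'"
      using Q unfolding Q_def by blast
    show ?thesis
      unfolding Q_def
    proof (intro bexI conjI)
      show "Comp C r' q' p k n \<in> Hom C r' p"
        using comp[OF obj(2,1) p'(1) n k(1)] .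
      show "Comp C r' p e \<pi>\<^sub>1 (Comp C r' q' p k n) = Comp C r' z e h \<tau>\<^sub>1"
        using assoc[OF obj(2,1) p'(1) e n k(1) p'(2)] assoc[OF obj(2,1) z e n \<rho> h] k(2) \<tau>(1)
        by simp
      show "Comp C r' p a \<pi>\<^sub>2 (Comp C r' q' p k n) = \<tau>\<^sub>2"
        using assoc[OF obj(2,1) p'(1) a n k(1) p'(3)] k(3) \<tau>(2) by simp
      show "Comp C r' p b ev (Comp C r' q' p k n) = Comp C r' q' b g' n"
        using assoc[OF obj(2,1) p'(1) b n k(1) ev] k(4) by simp
    qed
  qed
  obtain n where n: "n \<in> Hom C r q" "Comp C r q z \<rho>\<^sub>1 n = \<sigma>\<^sub>1" "Comp C r q a \<rho>\<^sub>2 n = \<sigma>\<^sub>2"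
    using q'(4)[OF r'(1-3)] by blast
  obtain m where m: "m \<in> Hom C q r" "Comp C q r z \<sigma>\<^sub>1 m = \<rho>\<^sub>1" "Comp C q r a \<sigma>\<^sub>2 m = \<rho>\<^sub>2"
    using r'(4)[OF q'(1-3)] by blast
  \<comment> \<open>\<open>n \<circ> m\<close> and the identity of \<open>q\<close> have the same
    composites with both projections, so they coincide.\<close>
  have "Comp C q q z \<rho>\<^sub>1 (Comp C q r q n m) = \<rho>\<^sub>1" "Comp C q q a \<rho>\<^sub>2 (Comp C q r q n m) = \<rho>\<^sub>2"
    using assoc[OF q'(1) r'(1) q'(1) z m(1) n(1) q'(2)]
      assoc[OF q'(1) r'(1) q'(1) a m(1) n(1) q'(3)] n m by simp_all
  moreover have "Comp C q q z \<rho>\<^sub>1 (Id C q) = \<rho>\<^sub>1" "Comp C q q a \<rho>\<^sub>2 (Id C q) = \<rho>\<^sub>2"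
    using category_unit(1)[OF C q'(1)] z a q'(2,3) by simp_all
  ultimately have nm: "Comp C q r q n m = Id C q"
    using q'(4)[OF q'(1-3)] comp[OF q'(1) r'(1) q'(1) m(1) n(1)] category_id[OF C q'(1)]
    by blast
  have gn: "Comp C r q b g n \<in> Hom C r b"
    using comp[OF r'(1) q'(1) b n(1) g] .
  have "Comp C q r b (Comp C r q b g n) m = g"
    using assoc[OF q'(1) r'(1) q'(1) b m(1) n(1) g] nm category_unit(1)[OF C q'(1) b g] by simp
  \<comment> \<open>Since \<open>g\<close> is \<open>(g \<circ> n) \<circ> m\<close>, pulling back
    along \<open>n\<close> and along \<open>m\<close> shows that both problems have the same
    solutions \<open>h\<close>; unique existence then passes from \<open>r\<close> to
    \<open>q\<close>.\<close>
  then have "Q r \<sigma>\<^sub>1 \<sigma>\<^sub>2 (Comp C r q b g n) h \<longleftrightarrow> Q q \<rho>\<^sub>1 \<rho>\<^sub>2 g h" if "h \<in> Hom C z e" for h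
    using Q_pull[OF _ that q'(1) r'(1) n(1) q'(2) n(2,3), of g]
      Q_pull[OF _ that r'(1) q'(1) m(1) r'(2) m(2,3), of "Comp C r q b g n"] by auto
  with univ_r[OF gn] show "\<exists>!h. h \<in> Hom C z e \<and>
      (\<exists>k\<in>Hom C q p. Comp C q p e \<pi>\<^sub>1 k = Comp C q z e h \<rho>\<^sub>1 \<and>
         Comp C q p a \<pi>\<^sub>2 k = \<rho>\<^sub>2 \<and> Comp C q p b ev k = g)"
    unfolding Q_def by blast
qed (fact e p ev)+

section \<open>The category of quasi-measurable spaces and its slices\<close>

lemma qms_category_simps [simp]:
  "Obj (qms_category \<Omega> M S) = {X. qm_space \<Omega> M X \<and> pts X \<in> S}"
  "Hom (qms_category \<Omega> M S) = qm_maps \<Omega>"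
  "Id (qms_category \<Omega> M S) X = (\<lambda>x\<in>pts X. x)"
  "Comp (qms_category \<Omega> M S) X Y Z g f = compose (pts X) g f"
  by (simp_all add: qms_category_def)

lemma category_qms: "category (qms_category \<Omega> M S)"
  unfolding category_def qms_category_simps
proof (intro conjI ballI)
  let ?Obj = "{X. qm_space \<Omega> M X \<and> pts X \<in> S}"
  show "(\<lambda>x\<in>pts X. x) \<in> qm_maps \<Omega> X X" if "X \<in> ?Obj" for X
    using that by (auto intro: qm_map_id)
  show "compose (pts X) g f \<in> qm_maps \<Omega> X Z"
    if "X \<in> ?Obj" "f \<in> qm_maps \<Omega> X Y" "g \<in> qm_maps \<Omega> Y Z" for X Y Z f g
    using that by (auto intro: qm_map_compose)
  show "compose (pts X) f (\<lambda>x\<in>pts X. x) = f" if "f \<in> qm_maps \<Omega> X Y" for X Y f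
    using qm_map_pt[OF that] qm_map_extensional[OF that] by (intro compose_Id) auto
  show "compose (pts X) (\<lambda>y\<in>pts Y. y) f = f" if "f \<in> qm_maps \<Omega> X Y" for X Y f
    using qm_map_pt[OF that] qm_map_extensional[OF that] by (intro Id_compose) auto
  show "compose (pts X) h (compose (pts X) g f) = compose (pts X) (compose (pts Y) h g) f"
    if "f \<in> qm_maps \<Omega> X Y" for X Y f g h
    using qm_map_pt[OF that] by (intro compose_assoc) auto
qed

lemma point_space_is_terminal:
  assumes "sample_space \<Omega> M" "{a} \<in> S"
  shows "is_terminal (qms_category \<Omega> M S) (point_space \<Omega> a)"
  unfolding is_terminal_def qms_category_simps
proof (intro conjI ballI)
  show "point_space \<Omega> a \<in> {X. qm_space \<Omega> M X \<and> pts X \<in> S}"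
    using assms(2) qm_space_point_space[OF assms(1)] by (simp add: point_space_def)
  show "\<exists>!h. h \<in> qm_maps \<Omega> Z (point_space \<Omega> a)" if "Z \<in> {X. qm_space \<Omega> M X \<and> pts X \<in> S}" for Z
    using that by (intro point_space_terminal[where M = M]) simp
qed

text \<open>The bridge from the abstract slice construction to spaces over \<open>T\<close>: through
  it the results on \<open>over_objs\<close> and \<open>over_maps\<close> become statements about a
  \<open>cat\<close>.\<close>

lemma slice_qms_simps [simp]:
  "Obj (slice (qms_category \<Omega> M S) T) = {A \<in> over_objs \<Omega> M T. over_pts A \<in> S}"
  "Hom (slice (qms_category \<Omega> M S) T) = over_maps \<Omega>"
  "Comp (slice (qms_category \<Omega> M S) T) A B C g f = compose (over_pts A) g f"
  by (auto simp: slice_def over_objs_def over_maps_def fun_eq_iff split: prod.splits)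

section \<open>Transport of structure\<close>

text \<open>The fibre products and exponentials of small spaces have their points in other types; they
  are replaced by isomorphic copies with points in the type of the small spaces.\<close>

definition over_iso ::
    "'w set \<Rightarrow> ('w, 'x, 't) over \<Rightarrow> ('w, 'y, 't) over \<Rightarrow> ('x \<Rightarrow> 'y) \<Rightarrow> ('y \<Rightarrow> 'x) \<Rightarrow> bool" where
  "over_iso \<Omega> A B i j \<longleftrightarrow> i \<in> over_maps \<Omega> A B \<and> j \<in> over_maps \<Omega> B A \<and>
     (\<forall>x\<in>over_pts A. j (i x) = x) \<and> (\<forall>y\<in>over_pts B. i (j y) = y)"

text \<open>The random variables of the copy are defined as the images of those of \<open>A\<close>,
  so \<open>f\<close> is quasi-measurable at once; injectivity recovers the original variable, so
  the inverse is too.\<close>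

lemma over_iso_image:
  assumes ss: "sample_space \<Omega> M" and A: "A \<in> over_objs \<Omega> M T" and inj: "inj_on f (over_pts A)"
  obtains B i j where "B \<in> over_objs \<Omega> M T" "over_pts B = f ` over_pts A" "over_iso \<Omega> A B i j"
proof -
  define g where "g = inv_into (over_pts A) f"
  have gf: "g (f x) = x" if "x \<in> over_pts A" for x
    using inj that by (simp add: g_def)
  define X where "X = QSpace (f ` over_pts A) ((\<lambda>\<xi>. \<lambda>\<omega>\<in>\<Omega>. f (\<xi> \<omega>)) ` rvs (fst A))"
  have rv: "(\<lambda>\<omega>\<in>\<Omega>. f (\<xi> \<omega>)) \<in> rvs X" if "\<xi> \<in> rvs (fst A)" for \<xi>
    using that by (simp add: X_def)
  have g_rv: "(\<lambda>\<omega>\<in>\<Omega>. g (\<eta> \<omega>)) \<in> rvs (fst A)" if "\<eta> \<in> rvs X" for \<eta>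
    using that by (auto simp: X_def gf over_obj_rv_pt[OF A] over_obj_rv_restrict[OF A]
        cong: restrict_cong)
  have X: "qm_space \<Omega> M X"
    unfolding qm_space_def
  proof (intro conjI ballI)
    show "rvs X \<subseteq> \<Omega> \<rightarrow>\<^sub>E pts X"
      by (auto simp: X_def over_obj_rv_pt[OF A])
    show "(\<lambda>\<omega>\<in>\<Omega>. c) \<in> rvs X" if "c \<in> pts X" for c
    proof -
      from that obtain x where "c = f x" "x \<in> over_pts A"
        by (auto simp: X_def)
      then show ?thesis
        using A rv[of "\<lambda>\<omega>\<in>\<Omega>. x"] qm_space_const[of \<Omega> M "fst A" x]
        by (simp add: over_objs_iff cong: restrict_cong)
    qed
    fix \<eta> \<phi> assume "\<eta> \<in> rvs X" "\<phi> \<in> M"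
    then obtain \<xi> where \<xi>: "\<xi> \<in> rvs (fst A)" "\<eta> = (\<lambda>\<omega>\<in>\<Omega>. f (\<xi> \<omega>))"
      by (auto simp: X_def)
    then show "compose \<Omega> \<eta> \<phi> \<in> rvs X"
      using rv[OF over_obj_reparam[OF A \<xi>(1) \<open>\<phi> \<in> M\<close>]] sample_space_pt[OF ss \<open>\<phi> \<in> M\<close>]
      by (simp add: compose_def cong: restrict_cong)
  qed
  define B where "B = (X, \<lambda>y\<in>pts X. snd A (g y))"
  have B: "B \<in> over_objs \<Omega> M T"
    unfolding over_objs_iff
  proof
    show "snd B \<in> qm_maps \<Omega> (fst B) T"
      unfolding B_def snd_conv fst_conv
    proof (rule qm_map_restrict[OF X])
      show "snd A (g y) \<in> pts T" if "y \<in> pts X" for y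
        using that by (auto simp: X_def gf intro: over_obj_base[OF A])
      show "(\<lambda>\<omega>\<in>\<Omega>. snd A (g (\<eta> \<omega>))) \<in> rvs T" if "\<eta> \<in> rvs X" for \<eta>
        using over_obj_base_rv[OF A g_rv[OF that]] by (simp cong: restrict_cong)
    qed
  qed (simp add: B_def X)
  moreover have "over_pts B = f ` over_pts A"
    by (simp add: B_def X_def)
  moreover have "restrict f (over_pts A) \<in> over_maps \<Omega> A B"
    using over_map_restrict[OF A, of f B] rv by (simp add: B_def gf) (simp add: X_def)
  moreover have "restrict g (over_pts B) \<in> over_maps \<Omega> B A"
    using g_rv by (intro over_map_restrict[OF B]) (auto simp: B_def, auto simp: X_def gf)
  ultimately show thesis
    by (intro that[of B "restrict f (over_pts A)" "restrict g (over_pts B)"])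
      (auto simp: over_iso_def gf)
qed

section \<open>Slices of small spaces\<close>

lemma over_map_extensional: "g \<in> over_maps \<Omega> A B \<Longrightarrow> g \<in> extensional (over_pts A)"
  unfolding over_maps_def by (auto intro: qm_map_extensional)

lemma over_iso_prod_proj:
  assumes ss: "sample_space \<Omega> M" and A: "A \<in> over_objs \<Omega> M T" and B: "B \<in> over_objs \<Omega> M T"
    and P: "P \<in> over_objs \<Omega> M T" and iso: "over_iso \<Omega> (over_prod \<Omega> A B) P i j"
  shows "(\<lambda>w\<in>over_pts P. fst (j w)) \<in> over_maps \<Omega> P A"
    and "(\<lambda>w\<in>over_pts P. snd (j w)) \<in> over_maps \<Omega> P B"
proof -
  have j: "j \<in> over_maps \<Omega> P (over_prod \<Omega> A B)"
    using iso by (simp add: over_iso_def)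
  have "compose (over_pts P) (\<lambda>z\<in>over_prod_pts A B. fst z) j = (\<lambda>w\<in>over_pts P. fst (j w))"
    "compose (over_pts P) (\<lambda>z\<in>over_prod_pts A B. snd z) j = (\<lambda>w\<in>over_pts P. snd (j w))"
    using over_map_pt[OF j] by (auto simp: compose_eq_iff)
  then show "(\<lambda>w\<in>over_pts P. fst (j w)) \<in> over_maps \<Omega> P A"
    "(\<lambda>w\<in>over_pts P. snd (j w)) \<in> over_maps \<Omega> P B"
    using over_map_compose[OF P j over_prod_fst[OF ss A B]]
      over_map_compose[OF P j over_prod_snd[OF ss A B]] by simp_all
qed

lemma slice_product:
  fixes A B P :: "('w, 'u, 'u) over"
  assumes ss: "sample_space \<Omega> M"
    and A: "A \<in> over_objs \<Omega> M T" and B: "B \<in> over_objs \<Omega> M T"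
    and P: "P \<in> over_objs \<Omega> M T" "over_pts P \<in> S"
    and iso: "over_iso \<Omega> (over_prod \<Omega> A B) P i j"
  shows "is_product (slice (qms_category \<Omega> M S) T) A B P
    (\<lambda>w\<in>over_pts P. fst (j w)) (\<lambda>w\<in>over_pts P. snd (j w))"
  unfolding is_product_def slice_qms_simps
proof (intro conjI ballI)
  note proj = over_iso_prod_proj[OF ss A B P(1) iso]
  show "P \<in> {A \<in> over_objs \<Omega> M T. over_pts A \<in> S}"
    using P by simp
  show "(\<lambda>w\<in>over_pts P. fst (j w)) \<in> over_maps \<Omega> P A"
    "(\<lambda>w\<in>over_pts P. snd (j w)) \<in> over_maps \<Omega> P B"
    by (fact proj)+
  fix Z f g
  assume "Z \<in> {A \<in> over_objs \<Omega> M T. over_pts A \<in> S}"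
    and f: "f \<in> over_maps \<Omega> Z A" and g: "g \<in> over_maps \<Omega> Z B"
  then have Z: "Z \<in> over_objs \<Omega> M T" by simp
  have i: "i \<in> over_maps \<Omega> (over_prod \<Omega> A B) P"
    and ji: "\<And>x. x \<in> over_prod_pts A B \<Longrightarrow> j (i x) = x"
    and ij: "\<And>y. y \<in> over_pts P \<Longrightarrow> i (j y) = y"
    using iso by (simp_all add: over_iso_def)
  note pair = over_prod_pair[OF A B Z f g]
  let ?h = "compose (over_pts Z) i (\<lambda>z\<in>over_pts Z. (f z, g z))"
  have h: "?h \<in> over_maps \<Omega> Z P"
    using over_map_compose[OF Z pair i] .
  have jh: "j (?h z) = (f z, g z)" if "z \<in> over_pts Z" for z
    using over_map_pt[OF pair that] that by (simp add: ji)
  \<comment> \<open>Both projection equations together say \<open>j (k z) = (f z, g z)\<close>; as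
    \<open>i\<close> undoes \<open>j\<close>, this determines \<open>k\<close>.\<close>
  have eqs: "compose (over_pts Z) (\<lambda>w\<in>over_pts P. fst (j w)) k = f \<and>
      compose (over_pts Z) (\<lambda>w\<in>over_pts P. snd (j w)) k = g \<longleftrightarrow>
      (\<forall>z\<in>over_pts Z. j (k z) = (f z, g z))" if "k \<in> over_maps \<Omega> Z P" for k
    using over_map_pt[OF that]
    by (auto simp: compose_eq_iff over_map_extensional[OF f] over_map_extensional[OF g]
        prod_eq_iff)
  show "\<exists>!h. h \<in> over_maps \<Omega> Z P \<and>
      compose (over_pts Z) (\<lambda>w\<in>over_pts P. fst (j w)) h = f \<and>
      compose (over_pts Z) (\<lambda>w\<in>over_pts P. snd (j w)) h = g"
  proof (rule ex1I)
    show "?h \<in> over_maps \<Omega> Z P \<and>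
      compose (over_pts Z) (\<lambda>w\<in>over_pts P. fst (j w)) ?h = f \<and>
      compose (over_pts Z) (\<lambda>w\<in>over_pts P. snd (j w)) ?h = g"
      using eqs[OF h] h jh by blast
    fix k
    assume k: "k \<in> over_maps \<Omega> Z P \<and>
      compose (over_pts Z) (\<lambda>w\<in>over_pts P. fst (j w)) k = f \<and>
      compose (over_pts Z) (\<lambda>w\<in>over_pts P. snd (j w)) k = g"
    then have km: "k \<in> over_maps \<Omega> Z P" by blast
    show "k = ?h"
    proof (rule over_map_eqI[OF km h])
      fix z assume z: "z \<in> over_pts Z"
      then have "j (k z) = j (?h z)"
        using k eqs[OF km] jh[OF z] by simp
      then show "k z = ?h z"
        using ij over_map_pt[OF km z] over_map_pt[OF h z] by metis
    qed
  qed
qed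

text \<open>The concrete exponential has the wrong point type to be an object of this slice, so
  \<open>E\<close> replaces it, and the products with \<open>A\<close> are copies as well. The proof
  rewrites the universal property of \<open>E\<close> until only the concrete fibre product and the
  concrete exponential occur.\<close>

lemma slice_exponential:
  fixes A B E :: "('w, 'u, 'u) over"
  assumes ss: "sample_space \<Omega> M" and T: "qm_space \<Omega> M T" "pts T \<in> S"
    and A: "A \<in> over_objs \<Omega> M T" "over_pts A \<in> S"
    and B: "B \<in> over_objs \<Omega> M T" "over_pts B \<in> S"
    and E: "E \<in> over_objs \<Omega> M T" "over_pts E \<in> S"
    and iso_E: "over_iso \<Omega> (over_exp \<Omega> M T A B) E i j"
    and prods: "\<And>Z :: ('w, 'u, 'u) over. Z \<in> over_objs \<Omega> M T \<Longrightarrow> over_pts Z \<in> S \<Longrightarrow>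
      \<exists>P :: ('w, 'u, 'u) over. \<exists>i j. P \<in> over_objs \<Omega> M T \<and> over_pts P \<in> S \<and>
        over_iso \<Omega> (over_prod \<Omega> Z A) P i j"
  shows "\<exists>P \<pi>\<^sub>1 \<pi>\<^sub>2 ev. is_exponential (slice (qms_category \<Omega> M S) T) A B E P \<pi>\<^sub>1 \<pi>\<^sub>2 ev"
proof -
  let ?E = "over_exp \<Omega> M T A B"
  let ?ev = "over_eval \<Omega> M T A B"
  note E0 = over_exp_obj[OF ss T(1) A(1) B(1)]
  have i: "i \<in> over_maps \<Omega> ?E E" and j: "j \<in> over_maps \<Omega> E ?E"
    and ji: "\<And>x. x \<in> over_exp_pts \<Omega> T A B \<Longrightarrow> j (i x) = x"
    and ij: "\<And>y. y \<in> over_pts E \<Longrightarrow> i (j y) = y"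
    using iso_E by (simp_all add: over_iso_def)
  obtain P :: "('w, 'u, 'u) over" and ip jp where P: "P \<in> over_objs \<Omega> M T" "over_pts P \<in> S"
    and iso_P: "over_iso \<Omega> (over_prod \<Omega> E A) P ip jp"
    using prods[OF E] by blast
  have ip: "ip \<in> over_maps \<Omega> (over_prod \<Omega> E A) P"
    and jp: "jp \<in> over_maps \<Omega> P (over_prod \<Omega> E A)"
    and jip: "\<And>x. x \<in> over_prod_pts E A \<Longrightarrow> jp (ip x) = x"
    using iso_P by (simp_all add: over_iso_def)
  note jA = times_id_map[OF ss E(1) A(1) E0 j]
  \<comment> \<open>From the copy \<open>P\<close> to the product of \<open>E\<close> and
    \<open>A\<close>, then by \<open>j \<times> id\<close> to the concrete exponential, where
    evaluation is available.\<close>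
  define ev where "ev = compose (over_pts P) ?ev (compose (over_pts P) (times_id E A j) jp)"
  have ev: "ev \<in> over_maps \<Omega> P B"
    unfolding ev_def
    using over_map_compose[OF P(1) over_map_compose[OF P(1) jp jA]
        over_eval_map[OF ss T(1) A(1) B(1)]] .
  have ev_apply: "ev w = ?ev (j (fst (jp w)), snd (jp w))" if "w \<in> over_pts P" for w
    using that over_map_pt[OF jp that] by (simp add: ev_def)
  have "is_exponential (slice (qms_category \<Omega> M S) T) A B E P
      (\<lambda>w\<in>over_pts P. fst (jp w)) (\<lambda>w\<in>over_pts P. snd (jp w)) ev"
  proof (rule is_exponentialI)
    show "category (slice (qms_category \<Omega> M S) T)"
      using T by (intro category_slice category_qms) simp
    show "is_product (slice (qms_category \<Omega> M S) T) E A P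
        (\<lambda>w\<in>over_pts P. fst (jp w)) (\<lambda>w\<in>over_pts P. snd (jp w))"
      by (rule slice_product[OF ss E(1) A(1) P iso_P])
    fix Z assume "Z \<in> Obj (slice (qms_category \<Omega> M S) T)"
    then have Z: "Z \<in> over_objs \<Omega> M T" "over_pts Z \<in> S" by simp_all
    obtain Q :: "('w, 'u, 'u) over" and iq jq where Q: "Q \<in> over_objs \<Omega> M T" "over_pts Q \<in> S"
      and iso_Q: "over_iso \<Omega> (over_prod \<Omega> Z A) Q iq jq"
      using prods[OF Z] by blast
    have iq: "iq \<in> over_maps \<Omega> (over_prod \<Omega> Z A) Q"
      and jq: "jq \<in> over_maps \<Omega> Q (over_prod \<Omega> Z A)"
      and jiq: "\<And>x. x \<in> over_prod_pts Z A \<Longrightarrow> jq (iq x) = x"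
      and ijq: "\<And>y. y \<in> over_pts Q \<Longrightarrow> iq (jq y) = y"
      using iso_Q by (simp_all add: over_iso_def)
    note proj = over_iso_prod_proj[OF ss Z(1) A(1) Q(1) iso_Q]
    let ?r = "\<lambda>w\<in>over_pts Q. fst (jq w)" and ?s = "\<lambda>w\<in>over_pts Q. snd (jq w)"
    let ?ex = "\<lambda>g h. \<exists>k\<in>over_maps \<Omega> Q P.
      compose (over_pts Q) (\<lambda>w\<in>over_pts P. fst (jp w)) k = compose (over_pts Q) h ?r \<and>
      compose (over_pts Q) (\<lambda>w\<in>over_pts P. snd (jp w)) k = ?s \<and>
      compose (over_pts Q) ev k = g"
    \<comment> \<open>The projection equations force \<open>k\<close> to be
      \<open>h \<times> id\<close> seen through the copies. Eliminating it leaves one equation on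
      the concrete fibre product.\<close>
    have ex_iff: "?ex g h \<longleftrightarrow> (\<forall>w\<in>over_prod_pts Z A. ?ev (j (h (fst w)), snd w) = g (iq w))"
      if g: "g \<in> over_maps \<Omega> Q B" and h: "h \<in> over_maps \<Omega> Z E" for g h
    proof -
      have k_iff: "compose (over_pts Q) (\<lambda>w\<in>over_pts P. fst (jp w)) k = compose (over_pts Q) h ?r \<and>
          compose (over_pts Q) (\<lambda>w\<in>over_pts P. snd (jp w)) k = ?s \<and>
          compose (over_pts Q) ev k = g \<longleftrightarrow>
          (\<forall>y\<in>over_pts Q. jp (k y) = (h (fst (jq y)), snd (jq y)) \<and>
             ?ev (j (h (fst (jq y))), snd (jq y)) = g y)"
        if k: "k \<in> over_maps \<Omega> Q P" for k
        using over_map_pt[OF k]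
        by (auto simp: compose_eq_iff over_map_extensional[OF g] ev_apply prod_eq_iff)
      show ?thesis
      proof
        assume "?ex g h"
        then obtain k where "k \<in> over_maps \<Omega> Q P"
          and "\<And>y. y \<in> over_pts Q \<Longrightarrow> ?ev (j (h (fst (jq y))), snd (jq y)) = g y"
          using k_iff by blast
        then show "\<forall>w\<in>over_prod_pts Z A. ?ev (j (h (fst w)), snd w) = g (iq w)"
          using over_map_pt[OF iq] jiq by fastforce
      next
        assume *: "\<forall>w\<in>over_prod_pts Z A. ?ev (j (h (fst w)), snd w) = g (iq w)"
        note hA = times_id_map[OF ss Z(1) A(1) E(1) h]
        \<comment> \<open>\<open>h \<times> id\<close> between the copies: decode \<open>Q\<close>
          by \<open>jq\<close>, apply it, encode into \<open>P\<close> by \<open>ip\<close>.\<close>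
        let ?k = "compose (over_pts Q) ip (compose (over_pts Q) (times_id Z A h) jq)"
        have k: "?k \<in> over_maps \<Omega> Q P"
          using over_map_compose[OF Q(1) over_map_compose[OF Q(1) jq hA] ip] .
        moreover have "jp (?k y) = (h (fst (jq y)), snd (jq y)) \<and>
            ?ev (j (h (fst (jq y))), snd (jq y)) = g y" if y: "y \<in> over_pts Q" for y
          using * y over_map_pt[OF jq y] over_map_pt[OF hA, of "jq y"] by (simp add: jip ijq)
        ultimately show "?ex g h"
          using k_iff[OF k] by (intro bexI[of _ ?k]) blast+
      qed
    qed
    have "\<exists>!h. h \<in> over_maps \<Omega> Z E \<and> ?ex g h" if g: "g \<in> over_maps \<Omega> Q B" for g
    proof -
      note PZ = over_prod_obj[OF ss Z(1) A(1)]
      \<comment> \<open>Pull \<open>g\<close> back from the copy \<open>Q\<close> to the fibre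
        product itself, where \<open>over_exp_universal\<close> applies.\<close>
      let ?g = "compose (over_prod_pts Z A) g iq"
      have g': "?g \<in> over_maps \<Omega> (over_prod \<Omega> Z A) B"
        using over_map_compose[OF PZ iq g] by simp
      have comp_iff: "compose (over_prod_pts Z A) ?ev (times_id Z A h) = ?g \<longleftrightarrow>
          (\<forall>w\<in>over_prod_pts Z A. ?ev (h (fst w), snd w) = g (iq w))" for h
        by (simp add: compose_eq_iff)
      have univ: "\<exists>!h. h \<in> over_maps \<Omega> Z ?E \<and>
          (\<forall>w\<in>over_prod_pts Z A. ?ev (h (fst w), snd w) = g (iq w))"
        using over_exp_universal[OF ss T(1) A(1) B(1) Z(1) g'] unfolding comp_iff .
      then obtain h where h: "h \<in> over_maps \<Omega> Z ?E"
        and h_ev: "\<forall>w\<in>over_prod_pts Z A. ?ev (h (fst w), snd w) = g (iq w)"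
        by blast
      have ih: "compose (over_pts Z) i h \<in> over_maps \<Omega> Z E"
        using over_map_compose[OF Z(1) h i] .
      show ?thesis
      proof (rule ex1I)
        have "\<forall>w\<in>over_prod_pts Z A. ?ev (j (compose (over_pts Z) i h (fst w)), snd w) = g (iq w)"
          using h_ev over_map_pt[OF h] by (simp add: over_prod_pts_iff ji)
        then show "compose (over_pts Z) i h \<in> over_maps \<Omega> Z E \<and> ?ex g (compose (over_pts Z) i h)"
          using ih ex_iff[OF g ih] by blast
        fix l assume l': "l \<in> over_maps \<Omega> Z E \<and> ?ex g l"
        then have l: "l \<in> over_maps \<Omega> Z E" by blast
        \<comment> \<open>Composed with \<open>j\<close>, a competing solution \<open>l\<close>
          solves the concrete problem and so equals \<open>h\<close>; applying \<open>i\<close>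
          gives \<open>l\<close> back.\<close>
        have jl: "compose (over_pts Z) j l \<in> over_maps \<Omega> Z ?E"
          using over_map_compose[OF Z(1) l j] .
        have "\<forall>w\<in>over_prod_pts Z A. ?ev (compose (over_pts Z) j l (fst w), snd w) = g (iq w)"
          using ex_iff[OF g l] l' by (simp add: over_prod_pts_iff)
        then have "compose (over_pts Z) j l = h"
          using univ jl h h_ev by blast
        then show "l = compose (over_pts Z) i h"
          using over_map_pt[OF l] by (intro over_map_eqI[OF l ih]) (auto simp: ij)
      qed
    qed
    then show "\<exists>q \<rho>\<^sub>1 \<rho>\<^sub>2. is_product (slice (qms_category \<Omega> M S) T) Z A q \<rho>\<^sub>1 \<rho>\<^sub>2 \<and>
      (\<forall>g\<in>Hom (slice (qms_category \<Omega> M S) T) q B. \<exists>!h. h \<in> Hom (slice (qms_category \<Omega> M S) T) Z E \<and>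
         (\<exists>k\<in>Hom (slice (qms_category \<Omega> M S) T) q P.
            Comp (slice (qms_category \<Omega> M S) T) q P E (\<lambda>w\<in>over_pts P. fst (jp w)) k =
              Comp (slice (qms_category \<Omega> M S) T) q Z E h \<rho>\<^sub>1 \<and>
            Comp (slice (qms_category \<Omega> M S) T) q P A (\<lambda>w\<in>over_pts P. snd (jp w)) k = \<rho>\<^sub>2 \<and>
            Comp (slice (qms_category \<Omega> M S) T) q P B ev k = g))"
      unfolding slice_qms_simps
      using slice_product[OF ss Z(1) A(1) Q iso_Q] by (intro exI[of _ Q] exI[of _ ?r] exI[of _ ?s]) blast
  qed (use A B E ev in simp_all)
  then show ?thesis by blast
qed

section \<open>Strong limit cardinals\<close>

text \<open>In a type with \<open>n\<close> elements, the complement of a point would give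
  \<open>2^(n-1) < n\<close>, contradicting \<open>n-1 < 2^(n-1)\<close>.\<close>

lemma strong_limit_infinite:
  assumes "\<And>S :: 'u set. S \<prec> (UNIV :: 'u set) \<Longrightarrow> Pow S \<prec> (UNIV :: 'u set)"
  shows "infinite (UNIV :: 'u set)"
proof
  assume fin: "finite (UNIV :: 'u set)"
  have less: "A \<prec> (UNIV :: 'u set) \<longleftrightarrow> card A < card (UNIV :: 'u set)" if "finite A" for A :: "'b set"
    using that fin by (auto simp: lesspoll_def lepoll_iff_card_le eqpoll_iff_card)
  fix u :: 'u
  let ?S = "UNIV - {u}"
  have card: "Suc (card ?S) = card (UNIV :: 'u set)"
    using fin by (metis UNIV_I card_Suc_Diff1)
  then have "2 ^ card ?S < card (UNIV :: 'u set)"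
    using assms[of ?S] less[of ?S] less[of "Pow ?S"] fin card by (simp add: card_Pow del: card_Diff_insert)
  moreover have "card ?S < 2 ^ card ?S"
    by (rule less_exp)
  ultimately show False
    using card by linarith
qed

lemma lepoll_total: "A \<lesssim> B \<or> B \<lesssim> A"
  using ordLeq_total[OF card_of_Well_order card_of_Well_order, of A B]
  by (auto simp: lepoll_def simp flip: card_of_ordLeq)

lemma Times_lepoll_infinite:
  assumes "infinite A" "B \<lesssim> A"
  shows "A \<times> B \<lesssim> A"
proof -
  have "A \<times> A \<approx> A"
    using card_of_Times_same_infinite[OF assms(1)] by (simp add: eqpoll_iff_card_of_ordIso)
  then show ?thesis
    using times_lepoll_mono[OF lepoll_refl assms(2)] lepoll_trans2 by blast
qed

text \<open>If a factor is infinite, the larger one is infinite and absorbs the smaller, so the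
  product is no larger than a set already below \<open>C\<close>.\<close>

lemma Times_lesspoll_infinite:
  assumes C: "infinite C" and A: "A \<prec> C" and B: "B \<prec> C"
  shows "A \<times> B \<prec> C"
proof (cases "finite A \<and> finite B")
  case True
  then show ?thesis
    using C by (simp add: finite_lesspoll_infinite)
next
  case False
  show ?thesis
  proof (cases "B \<lesssim> A")
    case True
    then have "infinite A"
      using False lepoll_iff_finite_card
      by (meson finite_lepoll_infinite eqpoll_finite_iff lepoll_antisym)
    then show ?thesis
      using Times_lepoll_infinite[OF _ True] A lesspoll_trans1 by blast
  next
    case False': False
    then have le: "A \<lesssim> B"
      using lepoll_total by blast
    then have "infinite B"
      using False
      by (meson finite_lepoll_infinite eqpoll_finite_iff lepoll_antisym)
    then have "B \<times> A \<prec> C"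
      using Times_lepoll_infinite[OF _ le] B lesspoll_trans1 by blast
    then show ?thesis
      using times_commute_eqpoll eq_lesspoll_trans by blast
  qed
qed

section \<open>Cardinal bounds for fibre products and exponentials\<close>

lemma over_prod_pts_lepoll: "over_prod_pts A B \<lesssim> over_pts A \<times> over_pts B"
  by (rule subset_imp_lepoll) (auto simp: over_prod_pts_iff)

text \<open>Replace each fibre map by its graph. The base point is kept alongside, because over
  points with empty fibres in \<open>A\<close> all graphs are empty.\<close>

lemma over_exp_pts_lepoll:
  "over_exp_pts \<Omega> T A B \<lesssim> pts T \<times> Pow (over_pts A \<times> over_pts B)"
proof -
  let ?graph = "\<lambda>(t, f). (t, (\<lambda>x. (x, f x)) ` pts (fibre \<Omega> A t))"
  have "inj_on ?graph (over_exp_pts \<Omega> T A B)"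
  proof (rule inj_onI)
    fix a b
    assume a: "a \<in> over_exp_pts \<Omega> T A B" and b: "b \<in> over_exp_pts \<Omega> T A B"
      and eq: "?graph a = ?graph b"
    have fst: "fst a = fst b"
      using eq by (simp add: case_prod_beta)
    have "snd a = snd b"
    proof (rule qm_map_eqI)
      show "snd a \<in> qm_maps \<Omega> (fibre \<Omega> A (fst a)) (fibre \<Omega> B (fst a))"
        "snd b \<in> qm_maps \<Omega> (fibre \<Omega> A (fst a)) (fibre \<Omega> B (fst b))"
        using a b fst by (simp_all add: over_exp_pts_iff)
      fix x assume "x \<in> pts (fibre \<Omega> A (fst a))"
      then have "(x, snd a x) \<in> snd (?graph a)"
        by (auto simp: case_prod_beta)
      then show "snd a x = snd b x"
        unfolding eq by (auto simp: case_prod_beta)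
    qed
    with fst show "a = b"
      by (simp add: prod_eq_iff)
  qed
  moreover have "?graph z \<in> pts T \<times> Pow (over_pts A \<times> over_pts B)"
    if "z \<in> over_exp_pts \<Omega> T A B" for z
    using that qm_map_pt[of "snd z" \<Omega> "fibre \<Omega> A (fst z)" "fibre \<Omega> B (fst z)"]
    by (auto simp: over_exp_pts_iff case_prod_beta)
  ultimately show ?thesis
    unfolding lepoll_def by blast
qed

text \<open>The hypothesis speaks of subsets of \<open>'u\<close> only; a small set in another type
  is first injected into \<open>'u\<close>.\<close>

lemma strong_limit_Pow:
  assumes limit: "\<And>S :: 'u set. S \<prec> (UNIV :: 'u set) \<Longrightarrow> Pow S \<prec> (UNIV :: 'u set)"
    and X: "X \<prec> (UNIV :: 'u set)"
  shows "Pow X \<prec> (UNIV :: 'u set)"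
proof -
  obtain f :: "_ \<Rightarrow> 'u" where f: "inj_on f X"
    using X by (auto simp: lesspoll_def lepoll_def)
  then have "Pow (f ` X) \<prec> (UNIV :: 'u set)"
    using X by (intro limit) simp
  moreover have "Pow X \<lesssim> Pow (f ` X)"
    unfolding lepoll_def using f by (intro exI[of _ "image f"]) (auto simp: inj_on_image_Pow)
  ultimately show ?thesis
    using lesspoll_trans1 by blast
qed

lemma small_over_copy:
  assumes ss: "sample_space \<Omega> M" and A: "A \<in> over_objs \<Omega> M T"
    and small: "over_pts A \<prec> (UNIV :: 'u set)"
  shows "\<exists>B :: ('w, 'u, 't) over. \<exists>i j.
    B \<in> over_objs \<Omega> M T \<and> over_pts B \<in> {S. S \<prec> (UNIV :: 'u set)} \<and> over_iso \<Omega> A B i j"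
proof -
  obtain f :: "_ \<Rightarrow> 'u" where f: "inj_on f (over_pts A)"
    using small by (auto simp: lesspoll_def lepoll_def)
  obtain B i j where "B \<in> over_objs \<Omega> M T" "over_pts B = f ` over_pts A" "over_iso \<Omega> A B i j"
    using over_iso_image[OF ss A f] by blast
  then show ?thesis
    using small f by (intro exI[of _ B]) auto
qed

section \<open>Cartesian closed slices and the final statement\<close>

lemma slice_cartesian_closed:
  fixes T :: "('w, 'u) qspace"
  assumes ss: "sample_space \<Omega> M"
    and limit: "\<And>S :: 'u set. S \<prec> (UNIV :: 'u set) \<Longrightarrow> Pow S \<prec> (UNIV :: 'u set)"
    and T: "qm_space \<Omega> M T" "pts T \<prec> (UNIV :: 'u set)"
  shows "cartesian_closed (slice (qms_category \<Omega> M {S. S \<prec> (UNIV :: 'u set)}) T)"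
proof -
  let ?S = "{S. S \<prec> (UNIV :: 'u set)}"
  let ?D = "slice (qms_category \<Omega> M ?S) T"
  note inf = strong_limit_infinite[OF limit]
  have prods: "\<exists>P :: ('w, 'u, 'u) over. \<exists>i j. P \<in> over_objs \<Omega> M T \<and> over_pts P \<in> ?S \<and>
      over_iso \<Omega> (over_prod \<Omega> A B) P i j"
    if "A \<in> over_objs \<Omega> M T" "over_pts A \<in> ?S" "B \<in> over_objs \<Omega> M T" "over_pts B \<in> ?S"
    for A B :: "('w, 'u, 'u) over"
  proof (rule small_over_copy[OF ss])
    show "over_prod \<Omega> A B \<in> over_objs \<Omega> M T"
      using over_prod_obj[OF ss] that by blast
    show "over_pts (over_prod \<Omega> A B) \<prec> (UNIV :: 'u set)"
      using lesspoll_trans1[OF over_prod_pts_lepoll Times_lesspoll_infinite[OF inf]] that by simp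
  qed
  show ?thesis
    unfolding cartesian_closed_def
  proof (intro conjI ballI)
    show "category ?D"
      using T by (intro category_slice category_qms) simp
    show "\<exists>t. is_terminal ?D t"
    proof
      show "is_terminal ?D (over_terminal T)"
        unfolding is_terminal_def slice_qms_simps
      proof (intro conjI ballI)
        show "over_terminal T \<in> {A \<in> over_objs \<Omega> M T. over_pts A \<in> ?S}"
          using over_terminal_obj[OF T(1)] T(2) by (simp add: over_terminal_def)
        show "\<exists>!h. h \<in> over_maps \<Omega> Z (over_terminal T)"
          if "Z \<in> {A \<in> over_objs \<Omega> M T. over_pts A \<in> ?S}" for Z
          using that by (intro over_terminal_terminal[where M = M]) simp
      qed
    qed
  next
    fix A B :: "('w, 'u, 'u) over"
    assume "A \<in> Obj ?D" "B \<in> Obj ?D"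
    then have A: "A \<in> over_objs \<Omega> M T" "over_pts A \<in> ?S"
      and B: "B \<in> over_objs \<Omega> M T" "over_pts B \<in> ?S"
      by simp_all
    obtain P :: "('w, 'u, 'u) over" and i j where P: "P \<in> over_objs \<Omega> M T" "over_pts P \<in> ?S"
      and iso: "over_iso \<Omega> (over_prod \<Omega> A B) P i j"
      using prods[OF A B] by (elim exE conjE)
    show "\<exists>p \<pi>\<^sub>1 \<pi>\<^sub>2. is_product ?D A B p \<pi>\<^sub>1 \<pi>\<^sub>2"
      using slice_product[OF ss A(1) B(1) P iso] by (intro exI)
    \<comment> \<open>Smallness of the bound on the exponential: products stay small since
      \<open>'u\<close> is infinite, the power set since it is a strong limit.\<close>
    have "over_pts A \<times> over_pts B \<prec> (UNIV :: 'u set)"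
      using A B by (intro Times_lesspoll_infinite[OF inf]) simp_all
    then have "pts T \<times> Pow (over_pts A \<times> over_pts B) \<prec> (UNIV :: 'u set)"
      by (intro Times_lesspoll_infinite[OF inf T(2)] strong_limit_Pow[OF limit])
    then have "over_pts (over_exp \<Omega> M T A B) \<prec> (UNIV :: 'u set)"
      using lesspoll_trans1[OF over_exp_pts_lepoll] by simp
    from small_over_copy[OF ss over_exp_obj[OF ss T(1) A(1) B(1)] this]
    obtain E :: "('w, 'u, 'u) over" and k l
      where E: "E \<in> over_objs \<Omega> M T" "over_pts E \<in> ?S"
        and iso_E: "over_iso \<Omega> (over_exp \<Omega> M T A B) E k l"
      by (elim exE conjE)
    have "pts T \<in> ?S"
      using T(2) by simp
    \<comment> \<open>\<open>A\<close> is fixed as second factor while the first varies: this gives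
      copies of the products with every small \<open>Z\<close>, including \<open>E\<close>.\<close>
    from slice_exponential[OF ss T(1) this A B E iso_E prods[OF _ _ A]]
    show "\<exists>e p \<pi>\<^sub>1 \<pi>\<^sub>2 ev. is_exponential ?D A B e p \<pi>\<^sub>1 \<pi>\<^sub>2 ev"
      by (rule exI)
  qed
qed

text \<open>The universal properties are spelled out because a \<open>cat\<close> has one point
  type. With \<open>'t\<close>, \<open>'x\<close>, \<open>'y\<close> and the type \<open>'z\<close>
  of the test spaces independent, they cover arbitrary spaces; the last conjunct states the
  categorical form for small spaces.\<close>

theorem theorem2p21:
  fixes \<Omega> :: "'w set" and M :: "('w \<Rightarrow> 'w) set" and u :: 'u
  assumes "sample_space \<Omega> M"
  shows
    "\<comment> \<open>the category, with the one-point space as terminal object\<close>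
     category (qms_category \<Omega> M (UNIV :: 'u set set)) \<and>
     is_terminal (qms_category \<Omega> M (UNIV :: 'u set set)) (point_space \<Omega> u) \<and>
     qm_space \<Omega> M (point_space \<Omega> (0::nat)) \<and>
     (\<forall>Z :: ('w, 'z) qspace. qm_space \<Omega> M Z \<longrightarrow>
        (\<exists>!h. h \<in> qm_maps \<Omega> Z (point_space \<Omega> (0::nat)))) \<and>
     \<comment> \<open>every slice is cartesian closed, for spaces with points in arbitrary types:
        terminal object, binary products, exponentials\<close>
     (\<forall>T :: ('w, 't) qspace. qm_space \<Omega> M T \<longrightarrow>
       (over_terminal T \<in> over_objs \<Omega> M T \<and>
        (\<forall>Z \<in> (over_objs \<Omega> M T :: ('w, 'z, 't) over set).
           \<exists>!h. h \<in> over_maps \<Omega> Z (over_terminal T))) \<and>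
       (\<forall>A \<in> (over_objs \<Omega> M T :: ('w, 'x, 't) over set).
        \<forall>B \<in> (over_objs \<Omega> M T :: ('w, 'y, 't) over set).
          (let P = over_prod \<Omega> A B;
               \<pi>\<^sub>1 = (\<lambda>z\<in>over_pts P. fst z);
               \<pi>\<^sub>2 = (\<lambda>z\<in>over_pts P. snd z) in
            P \<in> over_objs \<Omega> M T \<and> \<pi>\<^sub>1 \<in> over_maps \<Omega> P A \<and> \<pi>\<^sub>2 \<in> over_maps \<Omega> P B \<and>
            (\<forall>Z \<in> (over_objs \<Omega> M T :: ('w, 'z, 't) over set).
             \<forall>f \<in> over_maps \<Omega> Z A. \<forall>g \<in> over_maps \<Omega> Z B.
               \<exists>!h. h \<in> over_maps \<Omega> Z P \<and>
                    compose (over_pts Z) \<pi>\<^sub>1 h = f \<and> compose (over_pts Z) \<pi>\<^sub>2 h = g)) \<and>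
          (let E = over_exp \<Omega> M T A B; ev = over_eval \<Omega> M T A B in
            E \<in> over_objs \<Omega> M T \<and> ev \<in> over_maps \<Omega> (over_prod \<Omega> E A) B \<and>
            (\<forall>Z \<in> (over_objs \<Omega> M T :: ('w, 'z, 't) over set).
             \<forall>g \<in> over_maps \<Omega> (over_prod \<Omega> Z A) B.
               \<exists>!h. h \<in> over_maps \<Omega> Z E \<and>
                    compose (over_pts (over_prod \<Omega> Z A)) ev
                      (\<lambda>(z, x)\<in>over_pts (over_prod \<Omega> Z A). (h z, x)) = g)))) \<and>
     \<comment> \<open>consequently the category of spaces that are small relative to a type whose
        cardinality is a strong limit is locally cartesian closed\<close>
     ((\<forall>S :: 'u set. S \<prec> (UNIV :: 'u set) \<longrightarrow> Pow S \<prec> (UNIV :: 'u set)) \<longrightarrow>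
        locally_cartesian_closed (qms_category \<Omega> M {S :: 'u set. S \<prec> (UNIV :: 'u set)}) \<and>
        is_terminal (qms_category \<Omega> M {S :: 'u set. S \<prec> (UNIV :: 'u set)}) (point_space \<Omega> u))"
proof (intro conjI allI impI)
  show "category (qms_category \<Omega> M (UNIV :: 'u set set))"
    by (rule category_qms)
  show "is_terminal (qms_category \<Omega> M (UNIV :: 'u set set)) (point_space \<Omega> u)"
    by (rule point_space_is_terminal[OF assms UNIV_I])
  show "qm_space \<Omega> M (point_space \<Omega> (0::nat))"
    by (rule qm_space_point_space[OF assms])
  show "\<exists>!h. h \<in> qm_maps \<Omega> Z (point_space \<Omega> (0::nat))" if "qm_space \<Omega> M Z"
    for Z :: "('w, 'z) qspace"
    using that by (rule point_space_terminal)
next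
  fix T :: "('w, 't) qspace"
  assume T: "qm_space \<Omega> M T"
  show "over_terminal T \<in> over_objs \<Omega> M T"
    using T by (rule over_terminal_obj)
  show "\<forall>Z \<in> (over_objs \<Omega> M T :: ('w, 'z, 't) over set).
      \<exists>!h. h \<in> over_maps \<Omega> Z (over_terminal T)"
    by (intro ballI over_terminal_terminal)
  \<comment> \<open>Reversing \<open>times_id_def\<close> folds the lambda term of the exponential
    clause, so that the goal matches \<open>over_exp_universal\<close>.\<close>
  note simps = Let_def over_pts_prod times_id_def[symmetric]
  show "\<forall>A \<in> (over_objs \<Omega> M T :: ('w, 'x, 't) over set).
      \<forall>B \<in> (over_objs \<Omega> M T :: ('w, 'y, 't) over set).
        (let P = over_prod \<Omega> A B;
             \<pi>\<^sub>1 = (\<lambda>z\<in>over_pts P. fst z);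
             \<pi>\<^sub>2 = (\<lambda>z\<in>over_pts P. snd z) in
          P \<in> over_objs \<Omega> M T \<and> \<pi>\<^sub>1 \<in> over_maps \<Omega> P A \<and> \<pi>\<^sub>2 \<in> over_maps \<Omega> P B \<and>
          (\<forall>Z \<in> (over_objs \<Omega> M T :: ('w, 'z, 't) over set).
           \<forall>f \<in> over_maps \<Omega> Z A. \<forall>g \<in> over_maps \<Omega> Z B.
             \<exists>!h. h \<in> over_maps \<Omega> Z P \<and>
                  compose (over_pts Z) \<pi>\<^sub>1 h = f \<and> compose (over_pts Z) \<pi>\<^sub>2 h = g)) \<and>
        (let E = over_exp \<Omega> M T A B; ev = over_eval \<Omega> M T A B in
          E \<in> over_objs \<Omega> M T \<and> ev \<in> over_maps \<Omega> (over_prod \<Omega> E A) B \<and>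
          (\<forall>Z \<in> (over_objs \<Omega> M T :: ('w, 'z, 't) over set).
           \<forall>g \<in> over_maps \<Omega> (over_prod \<Omega> Z A) B.
             \<exists>!h. h \<in> over_maps \<Omega> Z E \<and>
                  compose (over_pts (over_prod \<Omega> Z A)) ev
                    (\<lambda>(z, x)\<in>over_pts (over_prod \<Omega> Z A). (h z, x)) = g))"
    unfolding simps
    by (intro ballI conjI over_prod_obj[OF assms] over_prod_fst[OF assms] over_prod_snd[OF assms]
        over_prod_universal[OF assms] over_exp_obj[OF assms T] over_eval_map[OF assms T]
        over_exp_universal[OF assms T])
next
  assume limit: "\<forall>S :: 'u set. S \<prec> (UNIV :: 'u set) \<longrightarrow> Pow S \<prec> (UNIV :: 'u set)"
  then show "locally_cartesian_closed (qms_category \<Omega> M {S :: 'u set. S \<prec> (UNIV :: 'u set)})"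
    unfolding locally_cartesian_closed_def
    by (auto intro: category_qms slice_cartesian_closed[OF assms])
  have "infinite (UNIV :: 'u set)"
    using limit strong_limit_infinite by blast
  then have "{u} \<prec> (UNIV :: 'u set)"
    by (simp add: finite_lesspoll_infinite)
  then show "is_terminal (qms_category \<Omega> M {S :: 'u set. S \<prec> (UNIV :: 'u set)}) (point_space \<Omega> u)"
    by (intro point_space_is_terminal[OF assms]) simp
qed

end
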